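(* Let $(M,g,J)$ be a closed connected Kähler surface and suppose that $A\in\mathcal A(g,J)$ has, at least at one point, an eigenvalue $\rho=\mathcal R+\mathrm i\mathcal I$ with $\mathcal I\neq0$. Then $A$ is parallel with respect to the Levi-Civita connection of $g$.
   Context: A Kähler surface: real dimension $4$, $J$ a complex structure, $g$ pseudo-Riemannian of arbitrary signature with $g(JX,Y)=-g(X,JY)$ and $\nabla J=0$ ($\nabla$ Levi-Civita of $g$). $\mathcal A(g,J)$ is the space of smooth $g$-symmetric $(1,1)$-tensor fields $A$ commuting with $J$ such that $\nabla_XA=X^\flat\otimes\Lambda+\Lambda^\flat\otimes X+(JX)^\flat\otimes J\Lambda+(J\Lambda)^\flat\otimes JX$ for all $X$, where $\Lambda=\frac14\operatorname{grad}_g\operatorname{tr}A$ and $X^\flat=g(X,\cdot)$. *)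

theory Defs
  imports "HOL-Analysis.Analysis"
begin

fun Ck_on :: "nat \<Rightarrow> ('a::euclidean_space) set \<Rightarrow> ('a \<Rightarrow> 'b::real_normed_vector) \<Rightarrow> bool" where
  "Ck_on 0 U f = continuous_on U f"
| "Ck_on (Suc k) U f = (f differentiable_on U \<and> continuous_on U f \<and>
      (\<forall>v. Ck_on k U (\<lambda>x. frechet_derivative f (at x) v)))"

definition smooth_on :: "('a::euclidean_space) set \<Rightarrow> ('a \<Rightarrow> 'b::real_normed_vector) \<Rightarrow> bool" where
  "smooth_on U f \<longleftrightarrow> (\<forall>k. Ck_on k U f)"

definition pd :: "(real^4 \<Rightarrow> 'b::real_normed_vector) \<Rightarrow> real^4 \<Rightarrow> 4 \<Rightarrow> 'b" where
  "pd F x i = frechet_derivative F (at x) (axis i 1)"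

definition jac :: "(real^4 \<Rightarrow> real^4) \<Rightarrow> real^4 \<Rightarrow> real^4^4" where
  "jac f x = matrix (frechet_derivative f (at x))"

type_synonym 'm chart = "'m set \<times> ('m \<Rightarrow> real^4)"

definition is_chart :: "'m topology \<Rightarrow> 'm chart \<Rightarrow> bool" where
  "is_chart X c \<longleftrightarrow> openin X (fst c) \<and> open (snd c ` fst c) \<and>
     homeomorphic_map (subtopology X (fst c)) (top_of_set (snd c ` fst c)) (snd c)"

definition cdom :: "'m chart \<Rightarrow> (real^4) set" where
  "cdom c = snd c ` fst c"

definition overlap :: "'m chart \<Rightarrow> 'm chart \<Rightarrow> (real^4) set" where
  "overlap c d = snd c ` (fst c \<inter> fst d)"

definition trans_map :: "'m chart \<Rightarrow> 'm chart \<Rightarrow> real^4 \<Rightarrow> real^4" where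
  "trans_map c d = snd d \<circ> inv_into (fst c) (snd c)"

text \<open>A smooth atlas on X (charts into open subsets of R^4, so no boundary).\<close>
definition smooth_atlas :: "'m topology \<Rightarrow> 'm chart set \<Rightarrow> bool" where
  "smooth_atlas X At \<longleftrightarrow> (\<forall>c\<in>At. is_chart X c) \<and> (\<Union>c\<in>At. fst c) = topspace X \<and>
     (\<forall>c\<in>At. \<forall>d\<in>At. smooth_on (overlap c d) (trans_map c d))"

definition closed_connected_4manifold :: "'m topology \<Rightarrow> 'm chart set \<Rightarrow> bool" where
  "closed_connected_4manifold X At \<longleftrightarrow> Hausdorff_space X \<and> compact_space X \<and>
     connected_space X \<and> smooth_atlas X At"

text \<open>A (1,1)-tensor field is given by its component matrices T c x (row = upper index) in
  every chart c, at coordinate points x; a (0,2)-tensor field likewise by matrices G c x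
  with entries g(d_i,d_j). They are required to be smooth in each chart and compatible
  under changes of coordinates.\<close>

definition smooth_11_field :: "'m chart set \<Rightarrow> ('m chart \<Rightarrow> real^4 \<Rightarrow> real^4^4) \<Rightarrow> bool" where
  "smooth_11_field At T \<longleftrightarrow> (\<forall>c\<in>At. smooth_on (cdom c) (T c)) \<and>
     (\<forall>c\<in>At. \<forall>d\<in>At. \<forall>x\<in>overlap c d.
        T d (trans_map c d x) ** jac (trans_map c d) x = jac (trans_map c d) x ** T c x)"

definition smooth_02_field :: "'m chart set \<Rightarrow> ('m chart \<Rightarrow> real^4 \<Rightarrow> real^4^4) \<Rightarrow> bool" where
  "smooth_02_field At G \<longleftrightarrow> (\<forall>c\<in>At. smooth_on (cdom c) (G c)) \<and>
     (\<forall>c\<in>At. \<forall>d\<in>At. \<forall>x\<in>overlap c d.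
        G c x = transpose (jac (trans_map c d) x) ** G d (trans_map c d x) ** jac (trans_map c d) x)"

definition pseudo_metric :: "'m chart set \<Rightarrow> ('m chart \<Rightarrow> real^4 \<Rightarrow> real^4^4) \<Rightarrow> bool" where
  "pseudo_metric At G \<longleftrightarrow> smooth_02_field At G \<and>
     (\<forall>c\<in>At. \<forall>x\<in>cdom c. transpose (G c x) = G c x \<and> det (G c x) \<noteq> 0)"

text \<open>christ Gc x i is the matrix with (a,k)-entry Gamma^a_{ik}.\<close>
definition christ :: "(real^4 \<Rightarrow> real^4^4) \<Rightarrow> real^4 \<Rightarrow> 4 \<Rightarrow> real^4^4" where
  "christ Gc x i = (\<chi> a k. (1/2) * (\<Sum>l\<in>UNIV. matrix_inv (Gc x) $ a $ l *
      (pd (\<lambda>y. Gc y $ k $ l) x i + pd (\<lambda>y. Gc y $ i $ l) x k - pd (\<lambda>y. Gc y $ i $ k) x l)))"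

definition covd :: "(real^4 \<Rightarrow> real^4^4) \<Rightarrow> (real^4 \<Rightarrow> real^4^4) \<Rightarrow> real^4 \<Rightarrow> 4 \<Rightarrow> real^4^4" where
  "covd Gc Tc x i = pd Tc x i + christ Gc x i ** Tc x - Tc x ** christ Gc x i"

definition nijenhuis :: "(real^4 \<Rightarrow> real^4^4) \<Rightarrow> real^4 \<Rightarrow> 4 \<Rightarrow> 4 \<Rightarrow> 4 \<Rightarrow> real" where
  "nijenhuis Jc x a b c = (\<Sum>d\<in>UNIV.
      Jc x $ d $ b * pd (\<lambda>y. Jc y $ a $ c) x d - Jc x $ d $ c * pd (\<lambda>y. Jc y $ a $ b) x d
    - Jc x $ a $ d * pd (\<lambda>y. Jc y $ d $ c) x b + Jc x $ a $ d * pd (\<lambda>y. Jc y $ d $ b) x c)"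

definition kaehler_surface ::
  "'m topology \<Rightarrow> 'm chart set \<Rightarrow> ('m chart \<Rightarrow> real^4 \<Rightarrow> real^4^4) \<Rightarrow> ('m chart \<Rightarrow> real^4 \<Rightarrow> real^4^4) \<Rightarrow> bool" where
  "kaehler_surface X At G J \<longleftrightarrow> pseudo_metric At G \<and> smooth_11_field At J \<and>
     (\<forall>c\<in>At. \<forall>x\<in>cdom c.
        J c x ** J c x = - mat 1 \<and>
        (\<forall>a b e. nijenhuis (J c) x a b e = 0) \<and>
        transpose (J c x) ** G c x = - (G c x ** J c x) \<and>
        (\<forall>i. covd (G c) (J c) x i = 0))"

definition outer :: "real^4 \<Rightarrow> real^4 \<Rightarrow> real^4^4" where
  "outer u v = (\<chi> i j. u $ i * v $ j)"

definition Lam :: "(real^4 \<Rightarrow> real^4^4) \<Rightarrow> (real^4 \<Rightarrow> real^4^4) \<Rightarrow> real^4 \<Rightarrow> real^4" where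
  "Lam Gc Ac x = (1/4) *\<^sub>R (matrix_inv (Gc x) *v (\<chi> b. pd (\<lambda>y. trace (Ac y)) x b))"

text \<open>Membership in A(g,J): g-symmetric, commuting with J, smooth, and
  nabla_X A = X^b (x) Lambda + Lambda^b (x) X + (JX)^b (x) J Lambda + (J Lambda)^b (x) JX,
  tested on the coordinate vector fields X = d_i (the identity is tensorial in X).\<close>
definition in_AgJ ::
  "'m chart set \<Rightarrow> ('m chart \<Rightarrow> real^4 \<Rightarrow> real^4^4) \<Rightarrow> ('m chart \<Rightarrow> real^4 \<Rightarrow> real^4^4)
    \<Rightarrow> ('m chart \<Rightarrow> real^4 \<Rightarrow> real^4^4) \<Rightarrow> bool" where
  "in_AgJ At G J A \<longleftrightarrow> smooth_11_field At A \<and>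
     (\<forall>c\<in>At. \<forall>x\<in>cdom c.
        G c x ** A c x = transpose (A c x) ** G c x \<and>
        A c x ** J c x = J c x ** A c x \<and>
        (\<forall>i. let L = Lam (G c) (A c) x; Xi = axis i 1; Gx = G c x; Jx = J c x in
           covd (G c) (A c) x i =
             outer L (Gx *v Xi) + outer Xi (Gx *v L)
             + outer (Jx *v L) (Gx *v (Jx *v Xi)) + outer (Jx *v Xi) (Gx *v (Jx *v L))))"

definition complex_eigenvalue :: "real^4^4 \<Rightarrow> complex \<Rightarrow> bool" where
  "complex_eigenvalue M \<rho> \<longleftrightarrow> (\<exists>v::complex^4. v \<noteq> 0 \<and>
     (\<chi> i. \<Sum>j\<in>UNIV. complex_of_real (M $ i $ j) * v $ j) = \<rho> *s v)"

end

theory Submission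
  imports Defs
begin

text \<open>
  Write \<open>R = tr A / 4\<close>, \<open>B = A - R Id\<close> and \<open>E = - tr B\<^sup>2 / 4\<close>. As \<open>A\<close> is \<open>J\<close>-linear and
  \<open>g\<close>-symmetric, its complex trace and determinant are real, so Cayley-Hamilton gives
  \<open>B\<^sup>2 = -E Id\<close>, and \<open>A\<close> has a non-real eigenvalue \<open>R + i \<surd>E\<close> exactly where \<open>E > 0\<close>. The
  equation for \<open>\<nabla>A\<close> yields \<open>dE = -2 dR \<circ> B\<close>: where \<open>E > 0\<close>, the function \<open>R + i \<surd>E\<close> is
  holomorphic for the almost complex structure \<open>B / \<surd>E\<close>. Hence \<open>E\<close> solves a linear elliptic
  equation without zeroth order term there, and by Hopf's strong maximum principle the set where
  \<open>E\<close> attains its positive maximum is open. It is also closed and \<open>M\<close> is connected, so \<open>E\<close> is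
  constant; then \<open>dR = 0\<close>, \<open>\<Lambda> = 0\<close> and \<open>\<nabla>A = 0\<close>.
\<close>

section \<open>Second derivatives\<close>

lemma has_real_derivative_along_line:
  fixes f :: "'a::real_normed_vector \<Rightarrow> real"
  assumes "(f has_derivative f') (at (p + s *\<^sub>R v))"
  shows "((\<lambda>s. f (p + s *\<^sub>R v)) has_real_derivative f' v) (at s)"
proof -
  have "((\<lambda>s. p + s *\<^sub>R v) has_derivative (\<lambda>h. h *\<^sub>R v)) (at s)"
    by (auto intro!: derivative_eq_intros)
  from has_derivative_compose[OF this assms]
  have "((\<lambda>s. f (p + s *\<^sub>R v)) has_derivative (\<lambda>h. f' (h *\<^sub>R v))) (at s)" .
  moreover have "f' (h *\<^sub>R v) = f' v * h" for h
    using linear_scale[OF has_derivative_linear[OF assms]] by simp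
  ultimately show ?thesis by (simp add: has_field_derivative_def)
qed

text \<open>The mean value theorem is applied twice: in direction \<open>v\<close> to the difference
  of \<open>f\<close> and its translate by \<open>t *\<^sub>R w\<close>, then in direction
  \<open>w\<close> to the resulting difference of first derivatives. The hypothesis
  \<open>mem\<close> keeps the whole parallelogram inside \<open>U\<close>.\<close>

lemma second_difference_mean_value:
  fixes f :: "'a::real_normed_vector \<Rightarrow> real"
  assumes "t > 0"
    and mem: "\<And>a b. 0 \<le> a \<Longrightarrow> a \<le> t \<Longrightarrow> 0 \<le> b \<Longrightarrow> b \<le> t \<Longrightarrow> x + a *\<^sub>R v + b *\<^sub>R w \<in> U"
    and f': "\<And>y. y \<in> U \<Longrightarrow> (f has_derivative f' y) (at y)"
    and f'': "\<And>y v. y \<in> U \<Longrightarrow> ((\<lambda>y. f' y v) has_derivative f'' y v) (at y)"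
  obtains a b where "0 \<le> a" "a \<le> t" "0 \<le> b" "b \<le> t"
    "f (x + t *\<^sub>R v + t *\<^sub>R w) - f (x + t *\<^sub>R v) - f (x + t *\<^sub>R w) + f x
      = t\<^sup>2 * f'' (x + a *\<^sub>R v + b *\<^sub>R w) v w"
proof -
  let ?g = "\<lambda>s. f ((x + t *\<^sub>R w) + s *\<^sub>R v) - f (x + s *\<^sub>R v)"
  have "DERIV ?g s :> f' ((x + t *\<^sub>R w) + s *\<^sub>R v) v - f' (x + s *\<^sub>R v) v"
    if "0 \<le> s" "s \<le> t" for s
    using mem[of s t] mem[of s 0] that \<open>t > 0\<close>
    by (intro DERIV_diff has_real_derivative_along_line f') (auto simp: algebra_simps)
  from MVT2[OF \<open>t > 0\<close> this] obtain a where a: "0 < a" "a < t"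
    "?g t - ?g 0 = t * (f' ((x + t *\<^sub>R w) + a *\<^sub>R v) v - f' (x + a *\<^sub>R v) v)"
    by auto
  have "DERIV (\<lambda>s. f' ((x + a *\<^sub>R v) + s *\<^sub>R w) v) s :> f'' ((x + a *\<^sub>R v) + s *\<^sub>R w) v w"
    if "0 \<le> s" "s \<le> t" for s
    using mem[of a s] that a
    by (intro has_real_derivative_along_line f'') auto
  from MVT2[OF \<open>t > 0\<close> this] obtain b where b: "0 < b" "b < t"
    "f' ((x + a *\<^sub>R v) + t *\<^sub>R w) v - f' (x + a *\<^sub>R v) v = t * f'' ((x + a *\<^sub>R v) + b *\<^sub>R w) v w"
    by auto
  show ?thesis
    using a b by (intro that[of a b]) (auto simp: algebra_simps power2_eq_square)
qed

text \<open>The second difference of \<open>f\<close> over a small parallelogram does not change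
  when \<open>v\<close> and \<open>w\<close> are swapped. Taking the mean values in either order
  expresses it by \<open>f''\<close> at points close to \<open>x\<close>, and continuity moves these
  points to \<open>x\<close>.\<close>

lemma second_derivative_symmetric:
  fixes f :: "'a::real_normed_vector \<Rightarrow> real"
  assumes "open U" "x \<in> U"
    and f': "\<And>y. y \<in> U \<Longrightarrow> (f has_derivative f' y) (at y)"
    and f'': "\<And>y v. y \<in> U \<Longrightarrow> ((\<lambda>y. f' y v) has_derivative f'' y v) (at y)"
    and cont: "\<And>v w. continuous_on U (\<lambda>y. f'' y v w)"
  shows "f'' x v w = f'' x w v"
proof -
  have ev: "\<exists>d>0. \<forall>a b. 0 \<le> a \<and> a \<le> d \<and> 0 \<le> b \<and> b \<le> d \<longrightarrow>
        x + a *\<^sub>R v + b *\<^sub>R w \<in> U \<and>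
        dist (f'' (x + a *\<^sub>R v + b *\<^sub>R w) v w) (f'' x v w) < e \<and>
        dist (f'' (x + a *\<^sub>R v + b *\<^sub>R w) w v) (f'' x w v) < e" if "e > 0" for e
  proof -
    have "isCont (\<lambda>y. f'' y v w) x" "isCont (\<lambda>y. f'' y w v) x"
      using cont assms(1,2) by (auto simp: continuous_on_eq_continuous_at)
    then have "((\<lambda>y. f'' y v w) \<longlongrightarrow> f'' x v w) (nhds x)" "((\<lambda>y. f'' y w v) \<longlongrightarrow> f'' x w v) (nhds x)"
      unfolding isCont_def by (auto intro: tendsto_at_iff_tendsto_nhds[THEN iffD1])
    then have "eventually (\<lambda>y. dist (f'' y v w) (f'' x v w) < e) (nhds x)"
      "eventually (\<lambda>y. dist (f'' y w v) (f'' x w v) < e) (nhds x)"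
      using \<open>e > 0\<close> by (auto simp: tendsto_iff)
    moreover have "eventually (\<lambda>y. y \<in> U) (nhds x)"
      using assms(1,2) by (rule eventually_nhds_in_open)
    ultimately have "eventually (\<lambda>y. y \<in> U \<and> dist (f'' y v w) (f'' x v w) < e \<and>
        dist (f'' y w v) (f'' x w v) < e) (nhds x)"
      by eventually_elim auto
    then obtain r where r: "r > 0" "\<And>y. dist y x < r \<Longrightarrow> y \<in> U \<and>
        dist (f'' y v w) (f'' x v w) < e \<and> dist (f'' y w v) (f'' x w v) < e"
      by (auto simp: eventually_nhds_metric)
    \<comment> \<open>With this side length the parallelogram stays within distance \<open>r\<close>
      of \<open>x\<close>; the summand 1 keeps the denominator positive when both vectors
      vanish.\<close>
    define d where "d = r / (norm v + norm w + 1)"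
    have pos: "norm v + norm w + 1 > 0" by (simp add: add_nonneg_pos)
    then have "d > 0" using r by (simp add: d_def)
    moreover have "dist (x + a *\<^sub>R v + b *\<^sub>R w) x < r" if "0 \<le> a" "a \<le> d" "0 \<le> b" "b \<le> d" for a b
    proof -
      have "dist (x + a *\<^sub>R v + b *\<^sub>R w) x = norm (a *\<^sub>R v + b *\<^sub>R w)"
        by (simp add: dist_norm add.assoc)
      also have "\<dots> \<le> a * norm v + b * norm w"
        using norm_triangle_ineq[of "a *\<^sub>R v" "b *\<^sub>R w"] that by simp
      also have "\<dots> \<le> d * norm v + d * norm w"
        using that by (intro add_mono mult_right_mono) auto
      also have "\<dots> < d * (norm v + norm w + 1)"
        using \<open>d > 0\<close> by (simp add: algebra_simps)
      also have "\<dots> = r" using pos by (simp add: d_def)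
      finally show ?thesis .
    qed
    ultimately show ?thesis using r(2) by blast
  qed
  have "dist (f'' x v w) (f'' x w v) < 2 * e" if "e > 0" for e :: real
  proof -
    obtain d where d: "d > 0" "\<And>a b. 0 \<le> a \<Longrightarrow> a \<le> d \<Longrightarrow> 0 \<le> b \<Longrightarrow> b \<le> d \<Longrightarrow>
        x + a *\<^sub>R v + b *\<^sub>R w \<in> U \<and>
        dist (f'' (x + a *\<^sub>R v + b *\<^sub>R w) v w) (f'' x v w) < e \<and>
        dist (f'' (x + a *\<^sub>R v + b *\<^sub>R w) w v) (f'' x w v) < e"
      using ev[OF \<open>e > 0\<close>] by blast
    have d': "x + a *\<^sub>R w + b *\<^sub>R v = x + b *\<^sub>R v + a *\<^sub>R w" for a b by simp
    obtain a b where ab: "0 \<le> a" "a \<le> d" "0 \<le> b" "b \<le> d"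
      "f (x + d *\<^sub>R v + d *\<^sub>R w) - f (x + d *\<^sub>R v) - f (x + d *\<^sub>R w) + f x
      = d\<^sup>2 * f'' (x + a *\<^sub>R v + b *\<^sub>R w) v w"
      using second_difference_mean_value[OF \<open>d > 0\<close>, of x v w U f f' f''] d f' f'' by blast
    obtain a' b' where ab': "0 \<le> a'" "a' \<le> d" "0 \<le> b'" "b' \<le> d"
      "f (x + d *\<^sub>R w + d *\<^sub>R v) - f (x + d *\<^sub>R w) - f (x + d *\<^sub>R v) + f x
      = d\<^sup>2 * f'' (x + a' *\<^sub>R w + b' *\<^sub>R v) w v"
      using second_difference_mean_value[OF \<open>d > 0\<close>, of x w v U f f' f''] d f' f''
      unfolding d' by blast
    have "d\<^sup>2 * f'' (x + a *\<^sub>R v + b *\<^sub>R w) v w = d\<^sup>2 * f'' (x + b' *\<^sub>R v + a' *\<^sub>R w) w v"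
      using ab(5) ab'(5) unfolding d' by linarith
    then have "f'' (x + a *\<^sub>R v + b *\<^sub>R w) v w = f'' (x + b' *\<^sub>R v + a' *\<^sub>R w) w v"
      using \<open>d > 0\<close> by simp
    then show ?thesis
      using d(2)[of a b] d(2)[of b' a'] ab ab' by (auto simp: dist_real_def)
  qed
  \<comment> \<open>If the two values differed, half their distance as \<open>e\<close> would make
    that distance smaller than itself.\<close>
  from this[of "dist (f'' x v w) (f'' x w v) / 2"] show ?thesis
    by (cases "f'' x v w = f'' x w v") auto
qed

text \<open>If the value were positive, the derivative in direction \<open>v\<close>, which is zero
  at \<open>z\<close>, would be positive just after \<open>z\<close>, and \<open>u\<close> would
  grow beyond its maximum. The second derivative is given at \<open>z\<close> only, so the argument
  uses the sign of the first derivative nearby.\<close>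

lemma second_derivative_nonpos_at_local_max:
  fixes u :: "'a::real_normed_vector \<Rightarrow> real"
  assumes "e > 0"
    and u': "\<And>y. y \<in> ball z e \<Longrightarrow> (u has_derivative u' y) (at y)"
    and u'': "((\<lambda>y. u' y v) has_derivative u'') (at z)"
    and mx: "\<And>y. y \<in> ball z e \<Longrightarrow> u y \<le> u z"
  shows "u'' v \<le> 0"
proof (rule ccontr)
  assume "\<not> u'' v \<le> 0"
  have z: "z \<in> ball z e" using \<open>e > 0\<close> by simp
  have u'z: "u' z = (\<lambda>h. 0)"
    using differential_zero_maxmin[OF z open_ball u'[OF z]] mx by blast
  have "DERIV (\<lambda>s. u' (z + s *\<^sub>R v) v) 0 :> u'' v"
    by (rule has_real_derivative_along_line) (use u'' in simp)
  from DERIV_pos_inc_right[OF this] \<open>\<not> u'' v \<le> 0\<close>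
  obtain d where d: "d > 0" "\<And>h. h > 0 \<Longrightarrow> h < d \<Longrightarrow> u' (z + h *\<^sub>R v) v > 0"
    using u'z by auto
  \<comment> \<open>The first bound keeps the derivative positive along the segment, the second
    keeps the segment inside the ball.\<close>
  define s where "s = min (d / 2) (e / (norm v + 1))"
  have "norm v + 1 > 0" by (simp add: add_nonneg_pos)
  have s: "s > 0" "s < d" using d(1) \<open>e > 0\<close> \<open>norm v + 1 > 0\<close> by (auto simp: s_def)
  have mem: "z + h *\<^sub>R v \<in> ball z e" if "0 \<le> h" "h \<le> s" for h
  proof -
    have "norm (h *\<^sub>R v) \<le> s * norm v" using that by (auto intro: mult_right_mono)
    also have "\<dots> < s * (norm v + 1)" using s by (simp add: algebra_simps)
    also have "\<dots> \<le> e / (norm v + 1) * (norm v + 1)"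
      using \<open>norm v + 1 > 0\<close> by (intro mult_right_mono) (auto simp: s_def)
    also have "\<dots> = e" using \<open>norm v + 1 > 0\<close> by simp
    finally show ?thesis by (simp add: dist_norm)
  qed
  obtain h where "0 < h" "h < s" "u (z + s *\<^sub>R v) - u (z + 0 *\<^sub>R v) = (s - 0) * u' (z + h *\<^sub>R v) v"
    using MVT2[OF s(1), of "\<lambda>s. u (z + s *\<^sub>R v)" "\<lambda>h. u' (z + h *\<^sub>R v) v"]
      has_real_derivative_along_line u' mem by blast
  moreover have "(s - 0) * u' (z + h *\<^sub>R v) v > 0"
    using d(2)[of h] \<open>0 < h\<close> \<open>h < s\<close> s by simp
  ultimately show False using mx[OF mem[of s]] s by simp
qed

section \<open>The strong maximum principle\<close>

lemma has_derivative_gaussian: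
  fixes y :: "'a::real_inner"
  shows "((\<lambda>x. exp (- \<alpha> * ((x - y) \<bullet> (x - y))) - K) has_derivative
    (\<lambda>h. - 2 * \<alpha> * ((x - y) \<bullet> h) * exp (- \<alpha> * ((x - y) \<bullet> (x - y))))) (at x)"
  by (auto intro!: derivative_eq_intros simp: inner_commute)

lemma has_second_derivative_gaussian:
  fixes y :: "'a::real_inner"
  shows "((\<lambda>x. - 2 * \<alpha> * ((x - y) \<bullet> v) * exp (- \<alpha> * ((x - y) \<bullet> (x - y)))) has_derivative
    (\<lambda>h. exp (- \<alpha> * ((x - y) \<bullet> (x - y))) *
      (4 * \<alpha>\<^sup>2 * ((x - y) \<bullet> v) * ((x - y) \<bullet> h) - 2 * \<alpha> * (h \<bullet> v)))) (at x)"
  by (auto intro!: derivative_eq_intros simp: inner_commute power2_eq_square algebra_simps)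

text \<open>Hopf's comparison function \<open>exp (-\<alpha> |x - y|\<^sup>2) - exp (-\<alpha> d\<^sup>2)\<close> is a strict subsolution
  away from the centre once \<open>\<alpha>\<close> is large.\<close>

lemma no_interior_touching_point:
  fixes u :: "'a::euclidean_space \<Rightarrow> real"
  assumes "open U"
    and u': "\<And>x. x \<in> U \<Longrightarrow> (u has_derivative u' x) (at x)"
    and u'': "\<And>x v. x \<in> U \<Longrightarrow> ((\<lambda>x. u' x v) has_derivative u'' x v) (at x)"
    and le: "\<And>x. x \<in> U \<Longrightarrow> u x \<le> M"
    and "c0 > 0"
    and c: "\<And>x. x \<in> U \<Longrightarrow> c0 \<le> c x \<and> c x \<le> C"
    and P: "\<And>x k. x \<in> U \<Longrightarrow> k \<in> Basis \<Longrightarrow> norm (P x k) \<le> C"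
    and b: "\<And>x. x \<in> U \<Longrightarrow> norm (b x) \<le> C"
    and eq: "\<And>x. x \<in> U \<Longrightarrow>
      (\<Sum>k\<in>Basis. c x * u'' x k k + u'' x (P x k) (P x k)) = u' x (b x)"
    and q: "q \<in> U" "u q = M" "dist y q = d" "d > 0"
    and less: "\<And>x. x \<in> cball y d \<Longrightarrow> x \<noteq> q \<Longrightarrow> u x < M"
  shows False
proof -
  obtain r0 where r0: "r0 > 0" "cball q r0 \<subseteq> U"
    using \<open>open U\<close> q(1) open_contains_cball by blast
  \<comment> \<open>The bound \<open>d / 2\<close> keeps the small ball around \<open>q\<close> away
    from the centre \<open>y\<close>, where the comparison function fails to be a
    subsolution.\<close>
  define r where "r = min r0 (d / 2)"
  have r: "r > 0" "r \<le> d / 2" "cball q r \<subseteq> U"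
    using r0 \<open>d > 0\<close> by (auto simp: r_def)
  have "C \<ge> 0" using b[OF q(1)] norm_ge_zero order_trans by blast
  define n where "n = real DIM('a)"
  have "n \<ge> 0" by (simp add: n_def)
  \<comment> \<open>After the factor \<open>g x * (2 * \<alpha>)\<close> is taken out,
    \<open>N\<close> bounds everything that does not carry a further \<alpha>: the \<open>c\<close>
    terms, the squares of the \<open>P x k\<close>, and the drift term with
    \<open>norm (x - y) \<le> 2 * d\<close>. The choice of \<alpha> below makes the leading term at
    least \<open>N + 1\<close>.\<close>
  define N where "N = C * n + n * C\<^sup>2 + 2 * d * C"
  have "N \<ge> 0" using \<open>C \<ge> 0\<close> \<open>n \<ge> 0\<close> \<open>d > 0\<close> by (simp add: N_def)
  define \<alpha> where "\<alpha> = 2 * (N + 1) / (c0 * d\<^sup>2)"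
  have "\<alpha> > 0" using \<open>N \<ge> 0\<close> \<open>c0 > 0\<close> \<open>d > 0\<close> by (simp add: \<alpha>_def)
  have \<alpha>N: "2 * \<alpha> * c0 * (d / 2)\<^sup>2 = N + 1"
    using \<open>c0 > 0\<close> \<open>d > 0\<close> by (simp add: \<alpha>_def field_simps power2_eq_square)
  define g where "g x = exp (- \<alpha> * ((x - y) \<bullet> (x - y)))" for x
  define w where "w x = g x - exp (- \<alpha> * (d * d))" for x
  define w' where "w' x h = - 2 * \<alpha> * ((x - y) \<bullet> h) * g x" for x h
  define w'' where "w'' x v h = g x * (4 * \<alpha>\<^sup>2 * ((x - y) \<bullet> v) * ((x - y) \<bullet> h) - 2 * \<alpha> * (h \<bullet> v))"
    for x v h
  have gpos: "g x > 0" for x by (simp add: g_def)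
  have w': "(w has_derivative w' x) (at x)" for x
    unfolding w_def w'_def g_def by (rule has_derivative_gaussian)
  have w'': "((\<lambda>x. w' x v) has_derivative w'' x v) (at x)" for x v
    unfolding w''_def w'_def g_def by (rule has_second_derivative_gaussian)
  have wq: "w q = 0"
    using q(3) by (simp add: w_def g_def dist_norm norm_minus_commute flip: power2_norm_eq_inner)
      (simp add: power2_eq_square)
  have sub: "(\<Sum>k\<in>Basis. c x * w'' x k k + w'' x (P x k) (P x k)) > w' x (b x)"
    if "x \<in> cball q r" for x
  proof -
    have xU: "x \<in> U" using that r by blast
    have "dist y x \<ge> d / 2" "dist y x \<le> 2 * d"
      using that r q(3) \<open>d > 0\<close> dist_triangle[of y q x] dist_triangle[of y x q]
      by (auto simp: dist_commute)
    then have nx: "norm (x - y) \<ge> d / 2" "norm (x - y) \<le> 2 * d"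
      by (auto simp: dist_norm norm_minus_commute)
    have s1: "(\<Sum>k\<in>Basis. ((x - y) \<bullet> k)\<^sup>2) = (norm (x - y))\<^sup>2"
      by (simp add: norm_eq_sqrt_inner euclidean_inner[of "x-y" "x-y"] power2_eq_square sum_nonneg)
    have s2: "(\<Sum>k\<in>Basis. (norm (P x k))\<^sup>2) \<le> n * C\<^sup>2"
    proof -
      have "(\<Sum>k\<in>Basis. (norm (P x k))\<^sup>2) \<le> (\<Sum>k\<in>(Basis::'a set). C\<^sup>2)"
        using P[OF xU] by (intro sum_mono power_mono) auto
      then show ?thesis by (simp add: n_def)
    qed
    have "(\<Sum>k\<in>Basis. c x * w'' x k k + w'' x (P x k) (P x k)) - w' x (b x)
      = (\<Sum>k\<in>Basis. g x * (4 * \<alpha>\<^sup>2 * (c x * ((x - y) \<bullet> k)\<^sup>2 + ((x - y) \<bullet> P x k)\<^sup>2)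
            - 2 * \<alpha> * (c x + (norm (P x k))\<^sup>2)))
          + g x * (2 * \<alpha> * ((x - y) \<bullet> b x))"
    proof -
      have "(\<Sum>k\<in>Basis. c x * w'' x k k + w'' x (P x k) (P x k))
        = (\<Sum>k\<in>Basis. g x * (4 * \<alpha>\<^sup>2 * (c x * ((x - y) \<bullet> k)\<^sup>2 + ((x - y) \<bullet> P x k)\<^sup>2)
            - 2 * \<alpha> * (c x + (norm (P x k))\<^sup>2)))"
        by (intro sum.cong refl)
          (simp add: w''_def power2_norm_eq_inner, simp add: algebra_simps power2_eq_square)
      then show ?thesis by (simp add: w'_def)
    qed
    also have "\<dots> = g x * (2 * \<alpha>) * (2 * \<alpha> * (c x * (norm (x - y))\<^sup>2
          + (\<Sum>k\<in>Basis. ((x - y) \<bullet> P x k)\<^sup>2))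
        - (c x * n + (\<Sum>k\<in>Basis. (norm (P x k))\<^sup>2)) + (x - y) \<bullet> b x)"
      unfolding s1[symmetric] n_def
      by (simp add: sum_distrib_left sum.distrib sum_subtractf right_diff_distrib distrib_left
          power2_eq_square mult.assoc mult.left_commute)
    also have "\<dots> > 0"
    proof -
      \<comment> \<open>The \<open>P\<close> directions contribute squares, so the leading term is
        bounded below by the isotropic part alone, where \<open>c0\<close> and the distance from
        \<open>y\<close> enter.\<close>
      have "c0 * (d / 2)\<^sup>2 \<le> c x * (norm (x - y))\<^sup>2"
        using c[OF xU] nx \<open>c0 > 0\<close> \<open>d > 0\<close> by (intro mult_mono power_mono) auto
      also have "\<dots> \<le> c x * (norm (x - y))\<^sup>2 + (\<Sum>k\<in>Basis. ((x - y) \<bullet> P x k)\<^sup>2)"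
        by (simp add: sum_nonneg)
      finally have "2 * \<alpha> * (c0 * (d / 2)\<^sup>2) \<le> 2 * \<alpha> * (c x * (norm (x - y))\<^sup>2 + (\<Sum>k\<in>Basis. ((x - y) \<bullet> P x k)\<^sup>2))"
        using \<open>\<alpha> > 0\<close> by (intro mult_left_mono) auto
      then have 1: "N + 1 \<le> 2 * \<alpha> * (c x * (norm (x - y))\<^sup>2 + (\<Sum>k\<in>Basis. ((x - y) \<bullet> P x k)\<^sup>2))"
        using \<alpha>N by (simp only: mult.assoc)
      have 2: "c x * n \<le> C * n" using c[OF xU] \<open>n \<ge> 0\<close> by (intro mult_right_mono) auto
      have "\<bar>(x - y) \<bullet> b x\<bar> \<le> norm (x - y) * norm (b x)" by (rule Cauchy_Schwarz_ineq2)
      also have "\<dots> \<le> 2 * d * C" using nx b[OF xU] \<open>d > 0\<close> by (intro mult_mono) auto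
      finally have 3: "\<bar>(x - y) \<bullet> b x\<bar> \<le> 2 * d * C" .
      have "2 * \<alpha> * (c x * (norm (x - y))\<^sup>2 + (\<Sum>k\<in>Basis. ((x - y) \<bullet> P x k)\<^sup>2))
        - (c x * n + (\<Sum>k\<in>Basis. (norm (P x k))\<^sup>2)) + (x - y) \<bullet> b x > 0"
        using 1 2 3 s2 unfolding N_def by linarith
      then show ?thesis using gpos[of x] \<open>\<alpha> > 0\<close> by simp
    qed
    finally show ?thesis by simp
  qed
  have contu: "continuous_on (cball q r) u"
    using r(3) u' has_derivative_continuous
    by (metis continuous_at_imp_continuous_on subsetD)
  have contw: "continuous_on S w" for S
    by (simp add: w' continuous_at_imp_continuous_on has_derivative_continuous[OF w'])
  \<comment> \<open>The sphere is split by \<open>cball y d\<close>. On the inner part, which is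
    compact and misses \<open>q\<close>, \<open>u\<close> is at most some \<open>m < M\<close> and
    \<open>w < 1\<close>, so \<open>M - m\<close> is small enough. On the outer part
    \<open>w\<close> is negative and any positive factor would do.\<close>
  obtain \<epsilon> where \<epsilon>: "\<epsilon> > 0" "\<And>x. x \<in> sphere q r \<Longrightarrow> u x + \<epsilon> * w x < M"
  proof -
    let ?K = "sphere q r \<inter> cball y d"
    have cK: "compact ?K" by (simp add: compact_Int)
    have Ksub: "?K \<subseteq> cball q r" by auto
    have Kless: "u x < M" if "x \<in> ?K" for x
      using that less r(1) by auto
    obtain m where m: "m < M" "\<And>x. x \<in> ?K \<Longrightarrow> u x \<le> m"
    proof (cases "?K = {}")
      case True
      then show ?thesis using that[of "M - 1"] by auto
    next
      case False
      obtain z where "z \<in> ?K" "\<And>x. x \<in> ?K \<Longrightarrow> u x \<le> u z"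
        using continuous_attains_sup[OF cK False continuous_on_subset[OF contu Ksub]] by blast
      then show ?thesis using that[of "u z"] Kless by blast
    qed
    have w1: "w x < 1" for x
    proof -
      have "g x \<le> 1" using \<open>\<alpha> > 0\<close> by (simp add: g_def)
      then show ?thesis by (simp add: w_def add_strict_increasing2 less_diff_eq)
          (smt (verit) exp_gt_zero)
    qed
    show ?thesis
    proof (rule that[of "M - m"])
      show "M - m > 0" using m by simp
      fix x assume x: "x \<in> sphere q r"
      show "u x + (M - m) * w x < M"
      proof (cases "x \<in> cball y d")
        case True
        have "(M - m) * w x < (M - m) * 1" using m(1) w1[of x] by (intro mult_strict_left_mono) auto
        then show ?thesis using m(2)[of x] True x by auto
      next
        case False
        then have "d < norm (x - y)" by (simp add: dist_norm norm_minus_commute)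
        then have "d * d < (x - y) \<bullet> (x - y)"
          using \<open>d > 0\<close> by (simp add: dot_square_norm power2_eq_square mult_strict_mono')
        then have "w x < 0" using \<open>\<alpha> > 0\<close> by (simp add: w_def g_def)
        then have "(M - m) * w x < 0" using m(1) by (simp add: mult_pos_neg)
        moreover have "u x \<le> M" using le[of x] x r(3) by auto
        ultimately show ?thesis by linarith
      qed
    qed
  qed
  \<comment> \<open>The perturbed function equals \<open>M\<close> at \<open>q\<close> but stays
    below \<open>M\<close> on the sphere, so it has an interior maximum \<open>z\<close>. There its
    gradient vanishes and its second derivatives are nonpositive, which contradicts the strict
    inequality \<open>sub\<close>.\<close>
  define f where "f x = u x + \<epsilon> * w x" for x
  define f' where "f' x h = u' x h + \<epsilon> * w' x h" for x h
  define f'' where "f'' x v h = u'' x v h + \<epsilon> * w'' x v h" for x v h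
  have f': "(f has_derivative f' x) (at x)" if "x \<in> U" for x
    unfolding f_def f'_def using u'[OF that] w' by (auto intro!: derivative_eq_intros)
  have f'': "((\<lambda>x. f' x v) has_derivative f'' x v) (at x)" if "x \<in> U" for x v
    unfolding f''_def f'_def using u''[OF that] w'' by (auto intro!: derivative_eq_intros)
  have "continuous_on (cball q r) f"
    unfolding f_def by (intro continuous_intros contu contw)
  then obtain z where z: "z \<in> cball q r" "\<And>x. x \<in> cball q r \<Longrightarrow> f x \<le> f z"
    using continuous_attains_sup[of "cball q r" f] r(1) by auto
  have "f q = M" by (simp add: f_def q wq)
  then have "f z \<ge> M" using z(2)[of q] r(1) by simp
  then have "z \<notin> sphere q r" using \<epsilon>(2)[of z] by (auto simp: f_def)
  then have zb: "z \<in> ball q r" using z(1) by auto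
  then obtain e where e: "e > 0" "ball z e \<subseteq> ball q r"
    using open_ball open_contains_ball by blast
  have eU: "ball z e \<subseteq> U" using e r(3) by (meson ball_subset_cball subset_trans)
  have zU: "z \<in> U" using zb r(3) by auto
  have mx: "f x \<le> f z" if "x \<in> ball z e" for x using that e z(2) by (auto simp: subset_iff)
  have "f' z = (\<lambda>h. 0)"
    using differential_zero_maxmin[OF _ open_ball f'[OF zU]] e(1) mx by (metis centre_in_ball)
  then have f'0: "u' z (b z) + \<epsilon> * w' z (b z) = 0" by (metis f'_def)
  have f''0: "f'' z v v \<le> 0" for v
    using second_derivative_nonpos_at_local_max[OF e(1), of z f f' v "f'' z v"] f' f'' zU eU mx by blast
  have "(\<Sum>k\<in>Basis. c z * f'' z k k + f'' z (P z k) (P z k)) \<le> 0"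
    using f''0 c[OF zU] \<open>c0 > 0\<close>
    by (intro sum_nonpos add_nonpos_nonpos mult_nonneg_nonpos) auto
  moreover have "(\<Sum>k\<in>Basis. c z * f'' z k k + f'' z (P z k) (P z k))
      = u' z (b z) + \<epsilon> * (\<Sum>k\<in>Basis. c z * w'' z k k + w'' z (P z k) (P z k))"
    by (simp add: eq[OF zU, symmetric] f''_def algebra_simps sum.distrib sum_distrib_left)
  moreover have "\<epsilon> * (\<Sum>k\<in>Basis. c z * w'' z k k + w'' z (P z k) (P z k)) > \<epsilon> * w' z (b z)"
    using sub[OF z(1)] \<epsilon>(1) by simp
  ultimately show False using f'0 by linarith
qed

text \<open>The level set is reached by a ball of its complement growing around a nearby point; halving
  that ball makes the contact point unique.\<close>

lemma strong_maximum_principle: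
  fixes u :: "'a::euclidean_space \<Rightarrow> real"
  assumes "open U"
    and u': "\<And>x. x \<in> U \<Longrightarrow> (u has_derivative u' x) (at x)"
    and u'': "\<And>x v. x \<in> U \<Longrightarrow> ((\<lambda>x. u' x v) has_derivative u'' x v) (at x)"
    and le: "\<And>x. x \<in> U \<Longrightarrow> u x \<le> M"
    and "c0 > 0"
    and c: "\<And>x. x \<in> U \<Longrightarrow> c0 \<le> c x \<and> c x \<le> C"
    and P: "\<And>x k. x \<in> U \<Longrightarrow> k \<in> Basis \<Longrightarrow> norm (P x k) \<le> C"
    and b: "\<And>x. x \<in> U \<Longrightarrow> norm (b x) \<le> C"
    and eq: "\<And>x. x \<in> U \<Longrightarrow>
      (\<Sum>k\<in>Basis. c x * u'' x k k + u'' x (P x k) (P x k)) = u' x (b x)"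
    and p: "p \<in> U" "u p = M"
  obtains e where "e > 0" "ball p e \<subseteq> U" "\<And>x. x \<in> ball p e \<Longrightarrow> u x = M"
proof -
  obtain r where r: "r > 0" "cball p r \<subseteq> U"
    using \<open>open U\<close> p(1) open_contains_cball by blast
  \<comment> \<open>Half the radius suffices because the point of the level set nearest to
    \<open>y\<close> is at most as far from \<open>y\<close> as \<open>p\<close> is, so the ball
    that reaches it remains in \<open>cball p r\<close>.\<close>
  have "u y = M" if y: "y \<in> ball p (r / 2)" for y
  proof (rule ccontr)
    assume "u y \<noteq> M"
    have "continuous_on (cball p r) u"
      using r(2) u' has_derivative_continuous
      by (metis continuous_at_imp_continuous_on subsetD)
    then have clS: "closed (cball p r \<inter> u -` {M})"
      by (intro continuous_closed_preimage) auto
    moreover have pS: "p \<in> cball p r \<inter> u -` {M}" using p r by auto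
    ultimately obtain q where q: "q \<in> cball p r \<inter> u -` {M}"
      "\<And>x. x \<in> cball p r \<inter> u -` {M} \<Longrightarrow> dist y q \<le> dist y x"
      using distance_attains_inf[OF clS, of y] by blast
    define d where "d = dist y q / 2"
    have "y \<noteq> q" using q(1) \<open>u y \<noteq> M\<close> by auto
    then have "d > 0" by (simp add: d_def)
    have "dist y p < r / 2" using y by (simp add: dist_commute)
    with q(2)[OF pS] have dq: "dist y q < r / 2" by simp
    define m where "m = y + (1/2) *\<^sub>R (q - y)"
    have mq: "dist m q = d"
    proof -
      have "m - q = (1/2) *\<^sub>R (y - q)"
        by (simp add: m_def algebra_simps) (simp flip: scaleR_left_distrib)
      then show ?thesis by (simp add: dist_norm d_def)
    qed
    have less: "u x < M" if x: "x \<in> cball m d" "x \<noteq> q" for x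
    proof -
      have e: "(1/2) *\<^sub>R (q - y) + (1/2) *\<^sub>R (q - y) = q - y"
        by (simp flip: scaleR_left_distrib)
      \<comment> \<open>By the parallelogram identity about the midpoint \<open>m\<close>, a point
        of \<open>cball m d\<close> other than \<open>q\<close> is strictly nearer to
        \<open>y\<close> than \<open>q\<close>. By minimality of \<open>q\<close> it lies off the
        level set.\<close>
      have par: "(norm (f + e))\<^sup>2 + (norm (f - e))\<^sup>2 = 2 * (norm f)\<^sup>2 + 2 * (norm e)\<^sup>2" for e f :: 'a
        by (simp add: power2_norm_eq_inner algebra_simps inner_commute)
      have 1: "(x - m) + (1/2) *\<^sub>R (q - y) = x - y" "(x - m) - (1/2) *\<^sub>R (q - y) = x - q"
        using e unfolding m_def by (simp_all add: algebra_simps)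
      have "norm (x - m) \<le> d" using x by (simp add: dist_norm norm_minus_commute)
      then have "(norm (x - m))\<^sup>2 \<le> d\<^sup>2" by (simp add: power_mono)
      moreover have "norm ((1/2) *\<^sub>R (q - y)) = d" by (simp add: d_def dist_norm norm_minus_commute)
      moreover have "(norm (x - q))\<^sup>2 > 0" using x(2) by simp
      ultimately have "(norm (x - y))\<^sup>2 < 4 * d\<^sup>2"
        using par[of "x - m" "(1/2) *\<^sub>R (q - y)"] unfolding 1 by (smt (verit))
      then have "(norm (x - y))\<^sup>2 < (2 * d)\<^sup>2" by (simp add: power_mult_distrib)
      then have "norm (x - y) < 2 * d" using \<open>d > 0\<close> by (meson less_imp_le mult_pos_pos power_less_imp_less_base zero_less_numeral)
      then have xy: "dist y x < dist y q" by (simp add: d_def dist_norm norm_minus_commute)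
      have "dist p x \<le> dist p y + dist y x" by (rule dist_triangle)
      then have "x \<in> cball p r" using xy dq y by simp
      then show ?thesis using q(2)[of x] xy le[of x] r(2) by force
    qed
    show False
      by (rule no_interior_touching_point[OF \<open>open U\<close> u' u'' le \<open>c0 > 0\<close> c P b eq _ _ mq \<open>d > 0\<close> less])
        (use q r in auto)
  qed
  then show ?thesis using r by (intro that[of "r / 2"]) auto
qed

section \<open>Hermitian endomorphisms\<close>

lemma matrix_uminus_mult:
  fixes M :: "real^'n^'m"
  shows "(- M) ** N = - (M ** N)"
  by (simp add: matrix_matrix_mult_def vec_eq_iff sum_negf)

lemma matrix_mult_uminus:
  fixes M :: "real^'n^'m"
  shows "M ** (- N) = - (M ** N)"
  by (simp add: matrix_matrix_mult_def vec_eq_iff sum_negf)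

lemma matrix_add_mult_distrib:
  fixes M :: "real^'n^'m"
  shows "(M + M') ** N = M ** N + M' ** N"
  by (simp add: matrix_matrix_mult_def vec_eq_iff sum.distrib distrib_right)

lemma matrix_uminus_vector_mult:
  fixes M :: "real^'n^'m"
  shows "(- M) *v w = - (M *v w)"
  by (simp add: matrix_vector_mult_def vec_eq_iff sum_negf)

text \<open>The columns of \<open>P\<close> are \<open>u\<close>, \<open>J *v u\<close>,
  \<open>v\<close>, \<open>J *v v\<close> with \<open>v\<close> outside the complex line spanned by
  \<open>u\<close>; in this basis \<open>J\<close> consists of two standard rotation blocks.\<close>

lemma complex_structure_adapted_basis:
  fixes J :: "real^4^4"
  assumes J: "J ** J = - mat 1"
  obtains P :: "real^4^4" where "invertible P"
    "\<And>i. (J ** P) $ i $ 1 = P $ i $ 2" "\<And>i. (J ** P) $ i $ 2 = - P $ i $ 1"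
    "\<And>i. (J ** P) $ i $ 3 = P $ i $ 4" "\<And>i. (J ** P) $ i $ 4 = - P $ i $ 3"
proof -
  have JJ: "J *v (J *v w) = - w" for w
    by (simp add: matrix_vector_mul_assoc J matrix_uminus_vector_mult)
  define u :: "real^4" where "u = axis 1 1"
  have "u \<noteq> 0" by (simp add: u_def axis_eq_0_iff)
  have "dim {u, J *v u} \<le> 2"
    by (rule order_trans[OF dim_le_card[OF span_superset]]) (auto simp: card_insert_if)
  then have "dim (span {u, J *v u}) \<le> 2" by simp
  moreover have "dim (UNIV :: (real^4) set) = 4" by (simp only: dim_UNIV) simp
  ultimately have "span {u, J *v u} \<noteq> UNIV"
    by (metis numeral_le_iff semiring_norm(69,71))
  then obtain v where v: "v \<notin> span {u, J *v u}" by blast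
  define P :: "real^4^4" where "P = (\<chi> i j. if j = 1 then u $ i else if j = 2 then (J *v u) $ i
     else if j = 3 then v $ i else (J *v v) $ i)"
  have Pcol: "P *v z = z$1 *\<^sub>R u + z$2 *\<^sub>R (J *v u) + z$3 *\<^sub>R v + z$4 *\<^sub>R (J *v v)" for z
    by (simp add: vec_eq_iff matrix_vector_mult_def[of P z], simp add: P_def sum_4 mult.commute)
  have "z = 0" if z: "P *v z = 0" for z
  proof -
    let ?a = "z$1" and ?b = "z$2" and ?c = "z$3" and ?d = "z$4"
    have 1: "?a *\<^sub>R u + ?b *\<^sub>R (J *v u) + ?c *\<^sub>R v + ?d *\<^sub>R (J *v v) = 0"
      using z Pcol by simp
    have 2: "?a *\<^sub>R (J *v u) - ?b *\<^sub>R u + ?c *\<^sub>R (J *v v) - ?d *\<^sub>R v = 0"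
      using arg_cong[OF 1, of "\<lambda>w. J *v w"]
      by (simp add: matrix_vector_right_distrib matrix_vector_mult_scaleR JJ)
    \<comment> \<open>Applying \<open>c - d J\<close> to the linear relation removes
      \<open>J *v v\<close>. As \<open>v\<close> is outside the complex line of \<open>u\<close>,
      this forces \<open>c\<close> and \<open>d\<close> to vanish; \<open>a - b J\<close> then does
      the same for \<open>u\<close>.\<close>
    have 3: "(?c\<^sup>2 + ?d\<^sup>2) *\<^sub>R v = (-(?a*?c + ?b*?d)) *\<^sub>R u + (?a * ?d - ?b * ?c) *\<^sub>R (J *v u)"
    proof -
      have "(?c\<^sup>2 + ?d\<^sup>2) *\<^sub>R v - ((-(?a*?c + ?b*?d)) *\<^sub>R u + (?a * ?d - ?b * ?c) *\<^sub>R (J *v u))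
        = ?c *\<^sub>R (?a *\<^sub>R u + ?b *\<^sub>R (J *v u) + ?c *\<^sub>R v + ?d *\<^sub>R (J *v v))
          - ?d *\<^sub>R (?a *\<^sub>R (J *v u) - ?b *\<^sub>R u + ?c *\<^sub>R (J *v v) - ?d *\<^sub>R v)"
        by (simp add: vec_eq_iff algebra_simps power2_eq_square)
      then show ?thesis unfolding 1 2 by simp
    qed
    have cd: "?c\<^sup>2 + ?d\<^sup>2 = 0"
    proof (rule ccontr)
      assume n: "?c\<^sup>2 + ?d\<^sup>2 \<noteq> 0"
      have "(?c\<^sup>2 + ?d\<^sup>2) *\<^sub>R v \<in> span {u, J *v u}"
        unfolding 3 by (intro span_add span_scale span_base) auto
      then have "(1 / (?c\<^sup>2 + ?d\<^sup>2)) *\<^sub>R (?c\<^sup>2 + ?d\<^sup>2) *\<^sub>R v \<in> span {u, J *v u}" by (rule span_scale)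
      moreover have "(1 / (?c\<^sup>2 + ?d\<^sup>2)) *\<^sub>R (?c\<^sup>2 + ?d\<^sup>2) *\<^sub>R v = v"
        unfolding scaleR_scaleR nonzero_eq_divide_eq[OF n, THEN iffD1, OF refl] by simp
      ultimately have "v \<in> span {u, J *v u}" by simp
      with v show False by simp
    qed
    then have cd: "?c = 0" "?d = 0" by (simp_all add: sum_power2_eq_zero_iff)
    have "(?a\<^sup>2 + ?b\<^sup>2) *\<^sub>R u = ?a *\<^sub>R (?a *\<^sub>R u + ?b *\<^sub>R (J *v u)) - ?b *\<^sub>R (?a *\<^sub>R (J *v u) - ?b *\<^sub>R u)"
      by (simp add: vec_eq_iff algebra_simps power2_eq_square)
    also have "\<dots> = 0" using 1 2 cd by simp
    finally have "?a\<^sup>2 + ?b\<^sup>2 = 0" using \<open>u \<noteq> 0\<close> by simp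
    then have "?a = 0" "?b = 0" by (simp_all add: sum_power2_eq_zero_iff)
    with cd show "z = 0" by (simp add: vec_eq_iff forall_4)
  qed
  then have "invertible P"
    by (simp add: invertible_left_inverse matrix_left_invertible_ker)
  moreover have col: "(J ** P) $ i $ j = (J *v column j P) $ i" for i j
    by (simp add: matrix_matrix_mult_def matrix_vector_mult_def column_def)
  have "column 1 P = u" "column 2 P = J *v u" "column 3 P = v" "column 4 P = J *v v"
    by (auto simp: column_def P_def vec_eq_iff)
  ultimately show ?thesis
    by (intro that[of P]) (simp_all add: col JJ, simp_all add: P_def)
qed

lemma trace_similar:
  fixes P :: "real^'n^'n"
  assumes "P ** Q = mat 1"
  shows "trace (Q ** M ** P) = trace M"
  by (metis assms matrix_mul_assoc matrix_mul_rid trace_mul_sym)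

text \<open>This is Cayley-Hamilton for the complex \<open>2 \<times> 2\<close> matrix of \<open>B\<close>: its complex trace
  is \<open>(trace B - i trace (J B)) / 2\<close>.\<close>

lemma square_of_traceless_complex_linear:
  fixes B J :: "real^4^4"
  assumes J: "J ** J = - mat 1" and comm: "B ** J = J ** B"
    and tr: "trace B = 0" "trace (J ** B) = 0"
  obtains \<alpha> \<beta> where "B ** B = \<alpha> *\<^sub>R mat 1 + \<beta> *\<^sub>R J"
proof -
  obtain P :: "real^4^4" where P: "invertible P"
    "\<And>i. (J ** P) $ i $ 1 = P $ i $ 2" "\<And>i. (J ** P) $ i $ 2 = - P $ i $ 1"
    "\<And>i. (J ** P) $ i $ 3 = P $ i $ 4" "\<And>i. (J ** P) $ i $ 4 = - P $ i $ 3"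
    using complex_structure_adapted_basis[OF J] by blast
  then obtain Q where Q: "P ** Q = mat 1" "Q ** P = mat 1" by (auto simp: invertible_def)
  \<comment> \<open>\<open>K\<close> and \<open>C\<close> are the matrices of \<open>J\<close> and
    \<open>B\<close> in the adapted basis.\<close>
  define K where "K = Q ** J ** P"
  define C where "C = Q ** B ** P"
  have K: "K $ i $ 1 = (mat 1 :: real^4^4) $ i $ 2" "K $ i $ 2 = - (mat 1 :: real^4^4) $ i $ 1"
    "K $ i $ 3 = (mat 1 :: real^4^4) $ i $ 4" "K $ i $ 4 = - (mat 1 :: real^4^4) $ i $ 3" for i
    unfolding K_def Q(2)[symmetric] matrix_mul_assoc[symmetric]
    unfolding matrix_matrix_mult_def[of Q]
    by (simp_all add: P(2-5) sum_negf)
  have n4: "(4::4) \<noteq> 1" "(4::4) \<noteq> 2" "(4::4) \<noteq> 3" "(3::4) \<noteq> 1" "(3::4) \<noteq> 2" "(2::4) \<noteq> 1"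
    "(1::4) \<noteq> 4" "(2::4) \<noteq> 4" "(3::4) \<noteq> 4" "(1::4) \<noteq> 3" "(2::4) \<noteq> 3" "(1::4) \<noteq> 2" by simp_all
  have K': "K$1$1=0" "K$2$1=1" "K$3$1=0" "K$4$1=0" "K$1$2=-1" "K$2$2=0" "K$3$2=0" "K$4$2=0"
    "K$1$3=0" "K$2$3=0" "K$3$3=0" "K$4$3=1" "K$1$4=0" "K$2$4=0" "K$3$4=-1" "K$4$4=0"
    using n4 by (simp_all only: K) (simp_all add: mat_def)
  have conj: "(Q ** M ** P) ** (Q ** N ** P) = Q ** (M ** N) ** P" for M N
  proof -
    have "(Q ** M ** P) ** (Q ** N ** P) = Q ** M ** (P ** Q) ** N ** P"
      by (simp add: matrix_mul_assoc)
    then show ?thesis by (simp add: Q matrix_mul_assoc)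
  qed
  have CK: "C ** K = K ** C" by (simp add: C_def K_def conj comm)
  have ck: "(C ** K) $ i $ j = (K ** C) $ i $ j" for i j by (simp add: CK)
  \<comment> \<open>Commuting with \<open>K\<close> means that each 2 by 2 block of \<open>C\<close>
    represents a complex number, so its second column is determined by its first.\<close>
  have e: "C$2$2 = C$1$1" "C$1$2 = - C$2$1" "C$2$4 = C$1$3" "C$1$4 = - C$2$3"
     "C$4$2 = C$3$1" "C$3$2 = - C$4$1" "C$4$4 = C$3$3" "C$3$4 = - C$4$3"
    using ck[of 2 1] ck[of 1 1] ck[of 2 3] ck[of 1 3] ck[of 4 1] ck[of 3 1] ck[of 4 3] ck[of 3 3]
    by (simp_all add: matrix_matrix_mult_def sum_4 K')
  have "trace C = 0" "trace (K ** C) = 0"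
    using tr by (simp_all add: C_def K_def conj trace_similar[OF Q(1)])
  then have t: "C$3$3 = - C$1$1" "C$4$3 = - C$2$1"
    by (simp_all add: trace_def matrix_matrix_mult_def sum_4 K' e)
  \<comment> \<open>Read as a complex matrix, \<open>C\<close> has rows \<open>(a, b)\<close> and
    \<open>(c, -a)\<close>, and its square is \<open>a * a + b * c\<close> times the identity; these
    are the real and imaginary parts of that scalar.\<close>
  let ?\<alpha> = "C$1$1 * C$1$1 - C$2$1 * C$2$1 + C$1$3 * C$3$1 - C$2$3 * C$4$1"
  let ?\<beta> = "2 * C$1$1 * C$2$1 + C$2$3 * C$3$1 + C$1$3 * C$4$1"
  have CC: "C ** C = ?\<alpha> *\<^sub>R mat 1 + ?\<beta> *\<^sub>R K"
    unfolding vec_eq_iff forall_4 matrix_matrix_mult_def sum_4 vec_lambda_beta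
      vector_add_component vector_scaleR_component e t K' mat_def
    by (simp add: algebra_simps)
  have unconj: "P ** (Q ** M ** P) ** Q = M" for M
  proof -
    have "P ** (Q ** M ** P) ** Q = (P ** Q) ** M ** (P ** Q)" by (simp add: matrix_mul_assoc)
    then show ?thesis by (simp add: Q)
  qed
  have lin: "P ** (a *\<^sub>R M + b *\<^sub>R N) ** Q = a *\<^sub>R (P ** M ** Q) + b *\<^sub>R (P ** N ** Q)" for a b M N
    by (simp add: matrix_add_ldistrib matrix_add_mult_distrib matrix_scalar_ac
        flip: scalar_matrix_assoc)
  have "B ** B = P ** (C ** C) ** Q" by (simp add: C_def conj unconj)
  also have "\<dots> = ?\<alpha> *\<^sub>R (P ** mat 1 ** Q) + ?\<beta> *\<^sub>R (P ** K ** Q)" by (simp only: CC lin)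
  also have "\<dots> = ?\<alpha> *\<^sub>R mat 1 + ?\<beta> *\<^sub>R J" by (simp add: Q K_def unconj)
  finally show ?thesis using that by blast
qed

text \<open>Conjugation by \<open>G\<close> turns \<open>C\<close> into minus its transpose, while
  transposition and conjugation both preserve the trace.\<close>

lemma trace_skew_adjoint:
  fixes C G :: "real^'n^'n"
  assumes "transpose C ** G = - (G ** C)" "det G \<noteq> 0"
  shows "trace C = 0"
proof -
  obtain H where H: "G ** H = mat 1" "H ** G = mat 1"
    using assms(2) by (auto simp: invertible_det_nz[symmetric] invertible_def)
  have "trace C = trace (transpose C)" by (simp add: trace_def transpose_def)
  also have "transpose C = (transpose C ** G) ** H" by (metis H(1) matrix_mul_assoc matrix_mul_rid)
  also have "\<dots> = - (G ** C ** H)" by (simp only: assms matrix_uminus_mult)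
  also have "trace \<dots> = - trace (G ** C ** H)" by (simp add: trace_def sum_negf)
  also have "trace (G ** C ** H) = trace C" by (rule trace_similar[OF H(2)])
  finally show ?thesis by simp
qed

section \<open>The traceless part and the invariant \<open>im_square\<close>\<close>

definition traceless_part :: "real^4^4 \<Rightarrow> real^4^4" where
  "traceless_part M = M - (trace M / 4) *\<^sub>R mat 1"

text \<open>For the endomorphisms of interest, with eigenvalues \<open>\<rho>\<close> and \<open>cnj \<rho>\<close> of multiplicity two,
  this is \<open>(Im \<rho>)\<^sup>2\<close>; it is negative if the eigenvalues are real and distinct.\<close>

definition im_square :: "real^4^4 \<Rightarrow> real" where
  "im_square M = - trace (traceless_part M ** traceless_part M) / 4"

lemma trace_scaleR: "trace (a *\<^sub>R (M :: real^'n^'n)) = a * trace M"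
  by (simp add: trace_def sum_distrib_left)

lemma trace_mat_1_4: "trace (mat 1 :: real^4^4) = 4"
  by (simp add: trace_I)

lemma trace_traceless_part: "trace (traceless_part M) = 0"
  by (simp add: traceless_part_def trace_sub trace_scaleR trace_mat_1_4)

lemma matrix_diff_mult_distrib:
  fixes M :: "real^'n^'m"
  shows "(M - M') ** N = M ** N - M' ** N" "N' ** (M - M') = N' ** M - N' ** M'"
  by (simp_all add: matrix_matrix_mult_def vec_eq_iff sum_subtractf left_diff_distrib right_diff_distrib)

lemma traceless_part_mult: "traceless_part M ** N = M ** N - (trace M / 4) *\<^sub>R N"
  by (simp add: traceless_part_def matrix_diff_mult_distrib flip: scalar_matrix_assoc)

lemma mult_traceless_part: "N ** traceless_part M = N ** M - (trace M / 4) *\<^sub>R N"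
  by (simp add: traceless_part_def matrix_diff_mult_distrib matrix_scalar_ac flip: scalar_matrix_assoc)

lemma transpose_traceless_part: "transpose (traceless_part M) = traceless_part (transpose M)"
  by (simp add: traceless_part_def transpose_def vec_eq_iff mat_def trace_def)

lemma trace_mult_outer: "trace (M ** outer u v) = v \<bullet> (M *v u)"
  by (simp add: trace_def outer_def matrix_matrix_mult_def matrix_vector_mult_def inner_vec_def
      sum_distrib_left mult_ac)

lemma dot_matrix_vector: "(M *v u) \<bullet> v = u \<bullet> (transpose M *v v)" for M :: "real^'n^'m"
  by (metis dot_lmul_matrix inner_commute transpose_matrix_vector)

lemma dot_transpose_matrix_vector: "v \<bullet> (M *v u) = (transpose M *v v) \<bullet> u" for M :: "real^'n^'m"
  by (simp add: inner_commute[of v] inner_commute[of _ u] dot_matrix_vector)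

section \<open>Self-adjoint complex linear endomorphisms at a point\<close>

locale hermitian_endomorphism =
  fixes G J A :: "real^4^4"
  assumes G_nondeg: "det G \<noteq> 0"
    and G_sym: "transpose G = G"
    and J_square: "J ** J = - mat 1"
    and J_skew: "transpose J ** G = - (G ** J)"
    and A_sym: "G ** A = transpose A ** G"
    and A_J: "A ** J = J ** A"
begin

abbreviation "B \<equiv> traceless_part A"

lemma B_sym: "transpose B ** G = G ** B"
  by (simp add: transpose_traceless_part traceless_part_mult mult_traceless_part A_sym)
    (simp add: trace_def transpose_def)

lemma B_J: "B ** J = J ** B"
  by (simp add: traceless_part_mult mult_traceless_part A_J)

text \<open>For self-adjoint \<open>C\<close> commuting with \<open>J\<close> the product
  \<open>J ** C\<close> is skew-adjoint. In complex terms, the complex trace of \<open>C\<close> is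
  real.\<close>

lemma trace_J_mult:
  assumes "transpose C ** G = G ** C" "C ** J = J ** C"
  shows "trace (J ** C) = 0"
proof (rule trace_skew_adjoint[OF _ G_nondeg])
  have "transpose (J ** C) ** G = transpose C ** (transpose J ** G)"
    by (simp add: matrix_transpose_mul matrix_mul_assoc)
  also have "\<dots> = - (transpose C ** G ** J)" by (simp add: J_skew matrix_mult_uminus matrix_mul_assoc)
  also have "\<dots> = - (G ** (J ** C))" by (simp add: assms flip: matrix_mul_assoc)
  finally show "transpose (J ** C) ** G = - (G ** (J ** C))" .
qed

text \<open>Cayley-Hamilton leaves a possible \<open>J\<close> component in \<open>B ** B\<close>.
  Since \<open>B ** B\<close> is again self-adjoint and complex linear, its complex trace is real,
  which removes that component; the remaining scalar is read off from the trace.\<close>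

lemma B_square: "B ** B = (- im_square A) *\<^sub>R mat 1"
proof -
  obtain \<alpha> \<beta> where ab: "B ** B = \<alpha> *\<^sub>R mat 1 + \<beta> *\<^sub>R J"
    using square_of_traceless_complex_linear[OF J_square B_J trace_traceless_part
        trace_J_mult[OF B_sym B_J]] .
  have "trace (J ** (B ** B)) = 0"
  proof (rule trace_J_mult)
    show "transpose (B ** B) ** G = G ** (B ** B)"
      by (simp add: matrix_transpose_mul B_sym flip: matrix_mul_assoc)
        (simp add: matrix_mul_assoc B_sym)
    show "B ** B ** J = J ** (B ** B)"
      by (simp add: B_J flip: matrix_mul_assoc) (simp add: B_J matrix_mul_assoc)
  qed
  moreover have "J ** (B ** B) = \<alpha> *\<^sub>R J - \<beta> *\<^sub>R mat 1"
    unfolding ab by (simp add: matrix_add_ldistrib matrix_scalar_ac J_square flip: scalar_matrix_assoc)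
  moreover have trJ: "trace J = 0"
    using trace_J_mult[of "mat 1"] by (simp add: transpose_mat)
  ultimately have "\<beta> = 0" by (simp add: trace_sub trace_scaleR trace_mat_1_4)
  with ab have "B ** B = \<alpha> *\<^sub>R mat 1" by simp
  moreover from this have "im_square A = - \<alpha>"
    by (simp add: im_square_def trace_scaleR trace_mat_1_4)
  ultimately show ?thesis by simp
qed

lemma B_B_vector: "B *v (B *v v) = (- im_square A) *\<^sub>R v"
  by (simp add: matrix_vector_mul_assoc B_square matrix_uminus_vector_mult scaleR_matrix_vector_assoc[symmetric])

text \<open>An eigenvector of \<open>A\<close> for \<rho> is one of \<open>B\<close> for \<mu> =
  \<rho> - tr A / 4. Applying \<open>B\<close> twice shows that \<mu> squared is the real number
  \<open>- im_square A\<close>; as \<mu> is not real, it is purely imaginary and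
  \<open>im_square A\<close> is the square of its imaginary part.\<close>

lemma im_square_pos:
  assumes "complex_eigenvalue A \<rho>" "Im \<rho> \<noteq> 0"
  shows "im_square A > 0"
proof -
  obtain v :: "complex^4" where v: "v \<noteq> 0"
    "(\<chi> i. \<Sum>j\<in>UNIV. complex_of_real (A $ i $ j) * v $ j) = \<rho> *s v"
    using assms(1) by (auto simp: complex_eigenvalue_def)
  define \<mu> where "\<mu> = \<rho> - of_real (trace A / 4)"
  have Av: "(\<Sum>j\<in>UNIV. complex_of_real (A $ i $ j) * v $ j) = \<rho> * v $ i" for i
    using v(2) by (simp add: vec_eq_iff)
  have Bij: "B $ i $ j = A $ i $ j - (if i = j then trace A / 4 else 0)" for i j
    by (simp add: traceless_part_def mat_def)
  have Bv: "(\<Sum>j\<in>UNIV. complex_of_real (B $ i $ j) * v $ j) = \<mu> * v $ i" for i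
  proof -
    have "(\<Sum>j\<in>UNIV. complex_of_real (B $ i $ j) * v $ j) =
      (\<Sum>j\<in>UNIV. complex_of_real (A $ i $ j) * v $ j - (if i = j then of_real (trace A / 4) * v $ j else 0))"
      by (intro sum.cong) (auto simp: Bij left_diff_distrib)
    then show ?thesis by (simp add: sum_subtractf Av \<mu>_def left_diff_distrib)
  qed
  obtain i where i: "v $ i \<noteq> 0" using v(1) by (auto simp: vec_eq_iff)
  have "\<mu> * (\<mu> * v $ i) = (\<Sum>j\<in>UNIV. complex_of_real (B $ i $ j) * (\<mu> * v $ j))"
    by (simp add: Bv[of i, symmetric] sum_distrib_left mult_ac)
  also have "\<dots> = (\<Sum>j\<in>UNIV. \<Sum>k\<in>UNIV. complex_of_real (B $ i $ j) * (complex_of_real (B $ j $ k) * v $ k))"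
    by (simp add: Bv[symmetric] sum_distrib_left)
  also have "\<dots> = (\<Sum>k\<in>UNIV. complex_of_real ((B ** B) $ i $ k) * v $ k)"
    by (subst sum.swap) (simp add: matrix_matrix_mult_def sum_distrib_right mult.assoc)
  also have "\<dots> = - of_real (im_square A) * v $ i"
    by (simp add: B_square mat_def if_distrib if_distribR sum_negf cong: if_cong)
  finally have "(\<mu> * \<mu>) * v $ i = (- of_real (im_square A)) * v $ i" by (simp add: mult.assoc)
  then have "\<mu> * \<mu> = - of_real (im_square A)" using i mult_right_cancel by blast
  then have "Re (\<mu> * \<mu>) = - im_square A" "Im (\<mu> * \<mu>) = 0" by simp_all
  moreover have "Im \<mu> \<noteq> 0" using assms(2) by (simp add: \<mu>_def)
  ultimately have "Re \<mu> = 0" "im_square A = (Im \<mu>)\<^sup>2" by (auto simp: power2_eq_square)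
  with \<open>Im \<mu> \<noteq> 0\<close> show ?thesis by simp
qed

text \<open>All four rank one terms contribute the same amount, because \<open>B\<close> is
  self-adjoint and commutes with \<open>J\<close>, and \<open>J\<close> is an isometry of
  \<open>G\<close>.\<close>

lemma trace_B_mult_covariant_derivative:
  "trace (B ** (outer L (G *v X) + outer X (G *v L)
      + outer (J *v L) (G *v (J *v X)) + outer (J *v X) (G *v (J *v L)))) = 4 * ((G *v L) \<bullet> (B *v X))"
proof -
  have sym: "(G *v u) \<bullet> (B *v w) = (G *v w) \<bullet> (B *v u)" for u w
  proof -
    have "(G *v u) \<bullet> (B *v w) = (transpose B *v (G *v u)) \<bullet> w"
      by (rule dot_transpose_matrix_vector)
    also have "\<dots> = (G *v (B *v u)) \<bullet> w" by (simp add: matrix_vector_mul_assoc B_sym)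
    also have "\<dots> = (B *v u) \<bullet> (G *v w)" by (simp add: dot_matrix_vector[of G] G_sym)
    finally show ?thesis by (simp add: inner_commute)
  qed
  have JB: "(G *v (J *v u)) \<bullet> (B *v (J *v w)) = (G *v u) \<bullet> (B *v w)" for u w
  proof -
    have "(G *v (J *v u)) \<bullet> (B *v (J *v w)) = (G *v (J *v u)) \<bullet> (J *v (B *v w))"
      by (simp add: matrix_vector_mul_assoc B_J)
    also have "\<dots> = (transpose J *v (G *v (J *v u))) \<bullet> (B *v w)"
      by (rule dot_transpose_matrix_vector)
    also have "transpose J *v (G *v (J *v u)) = (transpose J ** G ** J) *v u"
      by (simp add: matrix_vector_mul_assoc matrix_mul_assoc)
    also have "transpose J ** G ** J = - (G ** (J ** J))"
      by (simp only: J_skew matrix_uminus_mult matrix_mul_assoc)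
    also have "\<dots> = G" by (simp add: J_square matrix_mult_uminus)
    finally show ?thesis .
  qed
  show ?thesis
    by (simp add: matrix_add_ldistrib trace_add trace_mult_outer JB sym[of X L])
qed

end

section \<open>The elliptic equation\<close>

lemma linear_eq_sum_Basis:
  fixes f :: "'a::euclidean_space \<Rightarrow> 'b::real_vector"
  assumes "linear f"
  shows "f v = (\<Sum>k\<in>Basis. (v \<bullet> k) *\<^sub>R f k)"
proof -
  have "f v = f (\<Sum>k\<in>Basis. (v \<bullet> k) *\<^sub>R k)" by (simp add: euclidean_representation)
  also have "\<dots> = (\<Sum>k\<in>Basis. (v \<bullet> k) *\<^sub>R f k)"
    by (simp add: linear_sum[OF assms] linear_scale[OF assms])
  finally show ?thesis .
qed

text \<open>This is a product rule for the case where derivatives of \<open>f' y v\<close> are given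
  for each fixed \<open>v\<close> only. Expanding \<open>g y\<close> in a fixed basis reduces to
  that case; linearity of \<open>f''\<close> in its first argument then follows from uniqueness of
  derivatives.\<close>

lemma has_derivative_linear_moving_argument:
  fixes f' :: "'a::real_normed_vector \<Rightarrow> 'b::euclidean_space \<Rightarrow> 'c::real_normed_vector"
  assumes U: "open U" "x \<in> U"
    and lin: "\<And>y. y \<in> U \<Longrightarrow> linear (f' y)"
    and f'': "\<And>v. ((\<lambda>y. f' y v) has_derivative f'' v) (at x)"
    and g: "(g has_derivative g') (at x)"
  shows "((\<lambda>y. f' y (g y)) has_derivative (\<lambda>h. f'' (g x) h + f' x (g' h))) (at x)"
proof -
  have repr: "f' y w = (\<Sum>k\<in>Basis. (w \<bullet> k) *\<^sub>R f' y k)" if "y \<in> U" for y w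
    by (rule linear_eq_sum_Basis[OF lin[OF that]])
  have "((\<lambda>y. \<Sum>k\<in>Basis. (g x \<bullet> k) *\<^sub>R f' y k) has_derivative
      (\<lambda>h. \<Sum>k\<in>Basis. (g x \<bullet> k) *\<^sub>R f'' k h)) (at x)"
    by (auto intro!: derivative_eq_intros f'')
  from has_derivative_transform_within_open[OF this U, of "\<lambda>y. f' y (g x)"]
  have "((\<lambda>y. f' y (g x)) has_derivative (\<lambda>h. \<Sum>k\<in>Basis. (g x \<bullet> k) *\<^sub>R f'' k h)) (at x)"
    using repr[symmetric] by blast
  from has_derivative_unique[OF f'' this]
  have 1: "f'' (g x) h = (\<Sum>k\<in>Basis. (g x \<bullet> k) *\<^sub>R f'' k h)" for h
    by metis
  have "((\<lambda>y. \<Sum>k\<in>Basis. (g y \<bullet> k) *\<^sub>R f' y k) has_derivative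
      (\<lambda>h. \<Sum>k\<in>Basis. (g x \<bullet> k) *\<^sub>R f'' k h + (g' h \<bullet> k) *\<^sub>R f' x k)) (at x)"
    by (auto intro!: derivative_eq_intros f'' g)
  from has_derivative_transform_within_open[OF this U, of "\<lambda>y. f' y (g y)"]
  have "((\<lambda>y. f' y (g y)) has_derivative
      (\<lambda>h. \<Sum>k\<in>Basis. (g x \<bullet> k) *\<^sub>R f'' k h + (g' h \<bullet> k) *\<^sub>R f' x k)) (at x)"
    using repr[symmetric] by blast
  moreover have "(\<Sum>k\<in>Basis. (g x \<bullet> k) *\<^sub>R f'' k h + (g' h \<bullet> k) *\<^sub>R f' x k) = f'' (g x) h + f' x (g' h)" for h
    unfolding sum.distrib 1[of h] repr[OF U(2), of "g' h"] ..
  ultimately show ?thesis by simp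
qed

lemma continuous_on_linear_moving_argument:
  fixes f' :: "'a::topological_space \<Rightarrow> 'b::euclidean_space \<Rightarrow> 'c::real_normed_vector"
  assumes lin: "\<And>y. y \<in> U \<Longrightarrow> linear (f' y)"
    and f': "\<And>v. continuous_on U (\<lambda>y. f' y v)"
    and g: "continuous_on U g"
  shows "continuous_on U (\<lambda>y. f' y (g y))"
proof -
  have "continuous_on U (\<lambda>y. \<Sum>k\<in>Basis. (g y \<bullet> k) *\<^sub>R f' y k)"
    by (intro continuous_intros f' g)
  then show ?thesis
    by (rule continuous_on_eq) (simp add: linear_eq_sum_Basis[OF lin, symmetric])
qed

text \<open>The relations \<open>dE = -2 dR \<circ> B\<close> and \<open>dE \<circ> B = 2 E dR\<close> are Cauchy-Riemann equations for
  \<open>R + i \<surd>E\<close> and the almost complex structure \<open>B / \<surd>E\<close>; eliminating the Hessian of \<open>R\<close>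
  leaves a second order equation for \<open>E\<close> alone.\<close>

lemma cauchy_riemann_elimination:
  fixes E R :: "'a::euclidean_space \<Rightarrow> real" and B :: "'a \<Rightarrow> 'a \<Rightarrow> 'a"
  assumes U: "open U" "x \<in> U"
    and E': "\<And>y. y \<in> U \<Longrightarrow> (E has_derivative E' y) (at y)"
    and E'': "\<And>v. ((\<lambda>y. E' y v) has_derivative E'' v) (at x)"
    and R': "\<And>y. y \<in> U \<Longrightarrow> (R has_derivative R' y) (at y)"
    and R'': "\<And>v. ((\<lambda>y. R' y v) has_derivative R'' v) (at x)"
    and R''_sym: "\<And>v w. R'' v w = R'' w v"
    and B': "\<And>v. ((\<lambda>y. B y v) has_derivative B' v) (at x)"
    and EB: "\<And>y v. y \<in> U \<Longrightarrow> E' y v = - 2 * R' y (B y v)"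
    and EB2: "\<And>y v. y \<in> U \<Longrightarrow> E' y (B y v) = 2 * E y * R' y v"
  shows "E x * E'' v v + E'' (B x v) (B x v)
    = E' x ((2 * R' x v) *\<^sub>R B x v - B x (B' v v) - B' v (B x v))"
proof -
  have linE: "linear (E' y)" and linR: "linear (R' y)" if "y \<in> U" for y
    using E'[OF that] R'[OF that] has_derivative_linear by auto
  have "((\<lambda>y. R' y (B y v)) has_derivative (\<lambda>h. R'' (B x v) h + R' x (B' v h))) (at x)"
    by (rule has_derivative_linear_moving_argument[OF U linR R'' B'])
  then have "((\<lambda>y. - 2 * R' y (B y v)) has_derivative (\<lambda>h. - 2 * (R'' (B x v) h + R' x (B' v h)))) (at x)"
    by (rule has_derivative_mult_right)
  from has_derivative_transform_within_open[OF this U, of "\<lambda>y. E' y v"]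
  have "((\<lambda>y. E' y v) has_derivative (\<lambda>h. - 2 * (R'' (B x v) h + R' x (B' v h)))) (at x)"
    using EB by simp
  from has_derivative_unique[OF E'' this]
  have 1: "E'' v h = - 2 * (R'' (B x v) h + R' x (B' v h))" for h by metis
  have d1: "((\<lambda>y. E' y (B y v)) has_derivative (\<lambda>h. E'' (B x v) h + E' x (B' v h))) (at x)"
    by (rule has_derivative_linear_moving_argument[OF U linE E'' B'])
  have "((\<lambda>y. 2 * E y * R' y v) has_derivative (\<lambda>h. 2 * E x * R'' v h + 2 * E' x h * R' x v)) (at x)"
    by (auto intro!: derivative_eq_intros E'[OF U(2)] R'')
  from has_derivative_transform_within_open[OF this U, of "\<lambda>y. E' y (B y v)"]
  have d2: "((\<lambda>y. E' y (B y v)) has_derivative (\<lambda>h. 2 * E x * R'' v h + 2 * E' x h * R' x v)) (at x)"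
    using EB2 by simp
  have 2: "E'' (B x v) h + E' x (B' v h) = 2 * E x * R'' v h + 2 * E' x h * R' x v" for h
    using has_derivative_unique[OF d1 d2] by metis
  \<comment> \<open>Fact 1 with \<open>h = v\<close>, multiplied by \<open>E x\<close>, is added to
    fact 2 with \<open>h = B x v\<close>; the Hessian terms of \<open>R\<close> cancel by
    symmetry.\<close>
  have "E x * E'' v v + E'' (B x v) (B x v)
     = - (2 * E x * R' x (B' v v)) + 2 * E' x (B x v) * R' x v - E' x (B' v (B x v))"
  proof -
    have "E'' (B x v) (B x v) = 2 * E x * R'' (B x v) v + 2 * E' x (B x v) * R' x v - E' x (B' v (B x v))"
      using 2[of "B x v"] R''_sym[of v "B x v"] by simp
    then show ?thesis using 1[of v] by (simp only:) (simp add: algebra_simps)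
  qed
  \<comment> \<open>The relation \<open>EB2\<close> turns the remaining \<open>R'\<close> of the
    \<open>B'\<close> term into \<open>E'\<close>, while the factor \<open>R' x v\<close> is kept as
    a coefficient. The right-hand side is thereby linear in \<open>E'\<close>.\<close>
  also have "\<dots> = E' x ((2 * R' x v) *\<^sub>R B x v - B x (B' v v) - B' v (B x v))"
    by (simp add: EB2[OF U(2), symmetric] linear_diff[OF linE[OF U(2)]] linear_scale[OF linE[OF U(2)]])
  finally show ?thesis .
qed

section \<open>Differentiability and continuity of the matrix operations and of smooth
  fields\<close>

lemma bounded_linear_trace: "bounded_linear (trace :: real^'n^'n \<Rightarrow> real)"
  by (intro linear_conv_bounded_linear[THEN iffD1] linearI) (simp_all add: trace_add trace_scaleR)

lemma linear_traceless_part: "linear traceless_part"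
  by (rule linearI) (simp_all add: traceless_part_def trace_add trace_scaleR algebra_simps
      add_divide_distrib)

lemma bounded_linear_traceless_part: "bounded_linear traceless_part"
  using linear_traceless_part by (simp add: linear_conv_bounded_linear)

lemma bounded_bilinear_matrix_vector_mult:
  "bounded_bilinear ((*v) :: real^'n^'m \<Rightarrow> real^'n \<Rightarrow> real^'m)"
  unfolding bilinear_conv_bounded_bilinear[symmetric] bilinear_def
  by (auto intro!: linearI simp: matrix_vector_mult_add_rdistrib matrix_vector_right_distrib
      matrix_vector_mult_scaleR scaleR_matrix_vector_assoc)

lemma bounded_bilinear_trace_mult:
  "bounded_bilinear (\<lambda>M N :: real^'n^'n. trace (M ** N))"
  unfolding bilinear_conv_bounded_bilinear[symmetric] bilinear_def
  by (auto intro!: linearI simp: matrix_add_ldistrib matrix_add_mult_distrib trace_add trace_scaleR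
      matrix_scalar_ac simp flip: scalar_matrix_assoc)

lemma smooth_on_second_order:
  assumes "smooth_on U f" "open U"
  shows "\<And>x. x \<in> U \<Longrightarrow> (f has_derivative frechet_derivative f (at x)) (at x)"
    and "\<And>x v. x \<in> U \<Longrightarrow> ((\<lambda>y. frechet_derivative f (at y) v) has_derivative
      frechet_derivative (\<lambda>y. frechet_derivative f (at y) v) (at x)) (at x)"
    and "continuous_on U f"
    and "\<And>v. continuous_on U (\<lambda>x. frechet_derivative f (at x) v)"
    and "\<And>v w. continuous_on U (\<lambda>x. frechet_derivative (\<lambda>y. frechet_derivative f (at y) v) (at x) w)"
proof -
  \<comment> \<open>Level two already contains continuity of all second directional
    derivatives.\<close>
  have C: "Ck_on (Suc (Suc 0)) U f" using assms(1) unfolding smooth_on_def by blast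
  have works: "(h has_derivative frechet_derivative h (at x)) (at x)"
    if "h differentiable_on U" "x \<in> U" for h :: "'a \<Rightarrow> 'b" and x
  proof -
    have "h differentiable (at x within U)" using that unfolding differentiable_on_def by blast
    then have "h differentiable (at x)" using at_within_open[OF \<open>x \<in> U\<close> \<open>open U\<close>] by simp
    then show ?thesis by (simp only: frechet_derivative_works)
  qed
  from C have f: "f differentiable_on U" "continuous_on U f"
    and f': "\<And>v. Ck_on (Suc 0) U (\<lambda>x. frechet_derivative f (at x) v)"
    by auto
  from f' have f'd: "\<And>v. (\<lambda>x. frechet_derivative f (at x) v) differentiable_on U"
    and f'c: "\<And>v. continuous_on U (\<lambda>x. frechet_derivative f (at x) v)"
    and f''c: "\<And>v w. continuous_on U (\<lambda>x. frechet_derivative (\<lambda>y. frechet_derivative f (at y) v) (at x) w)"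
    by auto
  show "(f has_derivative frechet_derivative f (at x)) (at x)" if "x \<in> U" for x
    by (rule works[OF f(1) that])
  show "((\<lambda>y. frechet_derivative f (at y) v) has_derivative
      frechet_derivative (\<lambda>y. frechet_derivative f (at y) v) (at x)) (at x)" if "x \<in> U" for x v
    by (rule works[OF f'd that])
  show "continuous_on U f" by (rule f(2))
  show "continuous_on U (\<lambda>x. frechet_derivative f (at x) v)" for v by (rule f'c)
  show "continuous_on U (\<lambda>x. frechet_derivative (\<lambda>y. frechet_derivative f (at y) v) (at x) w)" for v w
    by (rule f''c)
qed

section \<open>The equation for \<open>A\<close> in a single coordinate domain\<close>

locale local_solution =
  fixes U :: "(real^4) set" and G J A :: "real^4 \<Rightarrow> real^4^4"
  assumes open_U: "open U"
    and smooth_A: "smooth_on U A"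
    and hermitian: "\<And>x. x \<in> U \<Longrightarrow> hermitian_endomorphism (G x) (J x) (A x)"
    and covd_A: "\<And>x i. x \<in> U \<Longrightarrow> covd G A x i =
        outer (Lam G A x) (G x *v axis i 1) + outer (axis i 1) (G x *v Lam G A x)
        + outer (J x *v Lam G A x) (G x *v (J x *v axis i 1))
        + outer (J x *v axis i 1) (G x *v (J x *v Lam G A x))"
begin

definition "A' x = frechet_derivative A (at x)"
definition "A'' x v = frechet_derivative (\<lambda>y. A' y v) (at x)"
definition "B x = traceless_part (A x)"
definition "R x = trace (A x) / 4"
definition "R' x v = trace (A' x v) / 4"
definition "R'' x v h = trace (A'' x v h) / 4"
definition "E x = im_square (A x)"
definition "E' x v = - trace (B x ** A' x v) / 2"
definition "E'' x v h = - (trace (traceless_part (A' x h) ** A' x v) + trace (B x ** A'' x v h)) / 2"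

lemma A': "x \<in> U \<Longrightarrow> (A has_derivative A' x) (at x)"
  unfolding A'_def by (rule smooth_on_second_order(1)[OF smooth_A open_U])

lemma A'': "x \<in> U \<Longrightarrow> ((\<lambda>y. A' y v) has_derivative A'' x v) (at x)"
  unfolding A''_def A'_def by (rule smooth_on_second_order(2)[OF smooth_A open_U])

lemma continuous_A: "continuous_on U A"
  and continuous_A': "continuous_on U (\<lambda>x. A' x v)"
  and continuous_A'': "continuous_on U (\<lambda>x. A'' x v w)"
  unfolding A''_def A'_def
  by (fact smooth_on_second_order(3-5)[OF smooth_A open_U])+

lemma linear_A': "x \<in> U \<Longrightarrow> linear (A' x)"
  using A' has_derivative_linear by blast

lemma R': "x \<in> U \<Longrightarrow> (R has_derivative R' x) (at x)"
  unfolding R_def R'_def divide_inverse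
  by (intro has_derivative_mult_left bounded_linear.has_derivative[OF bounded_linear_trace] A')

lemma R'': "x \<in> U \<Longrightarrow> ((\<lambda>y. R' y v) has_derivative R'' x v) (at x)"
  unfolding R'_def R''_def divide_inverse
  by (intro has_derivative_mult_left bounded_linear.has_derivative[OF bounded_linear_trace] A'')

lemma R''_symmetric: "x \<in> U \<Longrightarrow> R'' x v w = R'' x w v"
proof (rule second_derivative_symmetric[OF open_U _ R' R''])
  show "continuous_on U (\<lambda>y. R'' y v w)" for v w
    unfolding R''_def
    by (intro continuous_intros bounded_linear.continuous_on[OF bounded_linear_trace] continuous_A'') simp
qed

lemma B_derivative: "x \<in> U \<Longrightarrow> (B has_derivative (\<lambda>h. traceless_part (A' x h))) (at x)"
  unfolding B_def by (intro bounded_linear.has_derivative[OF bounded_linear_traceless_part] A')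

lemma Bv_derivative:
  "x \<in> U \<Longrightarrow> ((\<lambda>y. B y *v v) has_derivative (\<lambda>h. traceless_part (A' x h) *v v)) (at x)"
  by (intro bounded_linear.has_derivative[OF
        bounded_bilinear.bounded_linear_left[OF bounded_bilinear_matrix_vector_mult]] B_derivative)

text \<open>As \<open>B x\<close> has trace zero, the scalar part of \<open>M\<close> does not
  contribute. This lets \<open>A'\<close> replace the derivative of \<open>B\<close> in the formula
  for \<open>E'\<close>.\<close>

lemma trace_B_traceless_part: "trace (B x ** traceless_part M) = trace (B x ** M)"
  by (simp add: mult_traceless_part trace_sub trace_scaleR B_def trace_traceless_part)

lemma E': "x \<in> U \<Longrightarrow> (E has_derivative E' x) (at x)"
proof -
  assume x: "x \<in> U"
  have "((\<lambda>y. trace (B y ** B y)) has_derivative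
     (\<lambda>h. trace (B x ** traceless_part (A' x h)) + trace (traceless_part (A' x h) ** B x))) (at x)"
    by (rule bounded_bilinear.FDERIV[OF bounded_bilinear_trace_mult B_derivative[OF x] B_derivative[OF x]])
  then have "((\<lambda>y. (- 1 / 4) * trace (B y ** B y)) has_derivative
     (\<lambda>h. (- 1 / 4) * (trace (B x ** traceless_part (A' x h)) + trace (traceless_part (A' x h) ** B x)))) (at x)"
    by (rule has_derivative_mult_right)
  moreover have "(\<lambda>y. (- 1 / 4) * trace (B y ** B y)) = E"
    by (simp add: E_def[abs_def] im_square_def B_def fun_eq_iff)
  moreover have "(- 1 / 4) * (trace (B x ** traceless_part (A' x h)) + trace (traceless_part (A' x h) ** B x)) = E' x h" for h
    by (simp add: E'_def trace_mul_sym[of "traceless_part _"] trace_B_traceless_part)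
  ultimately show ?thesis by simp
qed

lemma E'': "x \<in> U \<Longrightarrow> ((\<lambda>y. E' y v) has_derivative E'' x v) (at x)"
proof -
  assume x: "x \<in> U"
  have "((\<lambda>y. (- 1 / 2) * trace (B y ** A' y v)) has_derivative
     (\<lambda>h. (- 1 / 2) * (trace (B x ** A'' x v h) + trace (traceless_part (A' x h) ** A' x v)))) (at x)"
    by (intro has_derivative_mult_right
       bounded_bilinear.FDERIV[OF bounded_bilinear_trace_mult B_derivative[OF x] A''[OF x]])
  then show ?thesis by (simp add: E'_def[abs_def] E''_def[abs_def] algebra_simps diff_divide_distrib)
qed

text \<open>Up to the factor 1/4, which is also the one in \<open>R\<close>, \<open>Lam\<close> is
  the metric gradient of the trace; lowering its index gives the differential of
  \<open>R\<close>.\<close>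

lemma G_mult_Lam:
  assumes x: "x \<in> U"
  shows "(G x *v Lam G A x) \<bullet> w = R' x w"
proof -
  interpret h: hermitian_endomorphism "G x" "J x" "A x" by (rule hermitian[OF x])
  have "invertible (G x)" using h.G_nondeg by (simp add: invertible_det_nz)
  then have "G x ** matrix_inv (G x) = mat 1"
    unfolding matrix_inv_def invertible_def by (rule someI2_ex) simp
  then have GL: "G x *v Lam G A x = (1/4) *\<^sub>R (\<chi> b. pd (\<lambda>y. trace (A y)) x b)"
    by (simp add: Lam_def matrix_vector_mult_scaleR matrix_vector_mul_assoc)
  have "((\<lambda>y. trace (A y)) has_derivative (\<lambda>h. trace (A' x h))) (at x)"
    by (intro bounded_linear.has_derivative[OF bounded_linear_trace] A' x)
  then have "pd (\<lambda>y. trace (A y)) x b = trace (A' x (axis b 1))" for b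
    unfolding pd_def by (simp add: frechet_derivative_at[symmetric])
  then have GLi: "(G x *v Lam G A x) $ i = R' x (axis i 1)" for i
    by (simp add: GL R'_def)
  have "R' x w = R' x (\<Sum>i\<in>UNIV. w $ i *\<^sub>R axis i 1)"
    by (simp add: basis_expansion flip: scalar_mult_eq_scaleR)
  also have "\<dots> = (\<Sum>i\<in>UNIV. w $ i * R' x (axis i 1))"
    using has_derivative_linear[OF R'[OF x]] by (simp add: linear_sum linear_scale)
  also have "\<dots> = (G x *v Lam G A x) \<bullet> w" by (simp add: inner_vec_def GLi mult.commute)
  finally show ?thesis ..
qed

text \<open>Since \<open>B\<close> commutes with \<open>A\<close>, the Christoffel terms cancel in
  the trace of \<open>B\<close> times the covariant derivative of \<open>A\<close>, leaving the
  partial derivative. The constant is -1/2 from \<open>E'\<close> times 4 from the four equal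
  terms.\<close>

lemma E'_eq:
  assumes x: "x \<in> U"
  shows "E' x v = - 2 * R' x (B x *v v)"
proof -
  interpret h: hermitian_endomorphism "G x" "J x" "A x" by (rule hermitian[OF x])
  have lin: "linear (E' x)" "linear (R' x)"
    using E'[OF x] R'[OF x] has_derivative_linear by auto
  have "E' x (axis i 1) = - 2 * R' x (B x *v axis i 1)" for i
  proof -
    let ?\<Gamma> = "christ G x i"
    have AB: "A x ** B x = B x ** A x"
      by (simp add: B_def traceless_part_mult mult_traceless_part)
    have comm: "trace (B x ** (?\<Gamma> ** A x)) = trace (B x ** (A x ** ?\<Gamma>))"
      by (metis AB matrix_mul_assoc trace_mul_sym)
    have "trace (B x ** A' x (axis i 1)) = trace (B x ** covd G A x i)"
      by (simp add: covd_def pd_def A'_def[symmetric] matrix_add_ldistrib matrix_diff_mult_distrib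
          trace_add trace_sub comm)
    also have "\<dots> = 4 * ((G x *v Lam G A x) \<bullet> (B x *v axis i 1))"
      by (simp only: covd_A[OF x] B_def h.trace_B_mult_covariant_derivative)
    finally show ?thesis by (simp add: E'_def G_mult_Lam[OF x])
  qed
  then have "E' x b = - 2 * R' x (B x *v b)" if "b \<in> Basis" for b
    using that by (auto simp: Basis_vec_def)
  moreover have "linear (\<lambda>v. - 2 * R' x (B x *v v))"
    by (rule linearI)
      (simp_all add: matrix_vector_right_distrib matrix_vector_mult_scaleR linear_add[OF lin(2)]
        linear_scale[OF lin(2)] algebra_simps)
  ultimately show ?thesis using linear_eq_stdbasis[OF lin(1)] by metis
qed

text \<open>The first relation is evaluated at \<open>B x *v v\<close>, where applying
  \<open>B\<close> twice multiplies by \<open>- E x\<close>.\<close>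

lemma E'_B_eq:
  assumes x: "x \<in> U"
  shows "E' x (B x *v v) = 2 * E x * R' x v"
proof -
  interpret h: hermitian_endomorphism "G x" "J x" "A x" by (rule hermitian[OF x])
  have "E' x (B x *v v) = - 2 * R' x ((- E x) *\<^sub>R v)"
    using h.B_B_vector[of v] by (simp add: E'_eq[OF x] B_def E_def)
  then show ?thesis using has_derivative_linear[OF R'[OF x]] by (simp add: linear_scale linear_neg)
qed

text \<open>This is the vector produced by \<open>cauchy_riemann_elimination\<close> for direction
  \<open>k\<close>. It is quadratic in \<open>k\<close> and enters the elliptic equation summed over
  the basis.\<close>

definition "drift x k = (2 * R' x k) *\<^sub>R (B x *v k) - B x *v (traceless_part (A' x k) *v k)
    - traceless_part (A' x (B x *v k)) *v k"

lemma elliptic_equation: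
  assumes x: "x \<in> U"
  shows "E x * E'' x v v + E'' x (B x *v v) (B x *v v) = E' x (drift x v)"
  unfolding drift_def
  by (rule cauchy_riemann_elimination[where B = "\<lambda>x v. B x *v v"
        and B' = "\<lambda>v h. traceless_part (A' x h) *v v", OF open_U x E' E''[OF x] R' R''[OF x] R''_symmetric[OF x]
        Bv_derivative[OF x] E'_eq E'_B_eq])

lemma continuous_B: "continuous_on U B"
  unfolding B_def
  by (intro bounded_linear.continuous_on[OF bounded_linear_traceless_part] continuous_A)

lemma continuous_drift: "continuous_on U (\<lambda>x. drift x k)"
proof -
  have BV: "continuous_on U (\<lambda>x. B x *v k)"
    by (intro bounded_bilinear.continuous_on[OF bounded_bilinear_matrix_vector_mult] continuous_B
        continuous_on_const)
  have "continuous_on U (\<lambda>x. R' x k)"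
    unfolding R'_def
    by (intro continuous_intros bounded_linear.continuous_on[OF bounded_linear_trace] continuous_A') simp
  moreover have "continuous_on U (\<lambda>x. A' x (B x *v k))"
    by (rule continuous_on_linear_moving_argument[OF linear_A' continuous_A' BV])
  ultimately show ?thesis
    unfolding drift_def
    by (intro continuous_on_diff continuous_on_scaleR continuous_on_mult continuous_on_const BV
        continuous_B continuous_A'
        bounded_bilinear.continuous_on[OF bounded_bilinear_matrix_vector_mult]
        bounded_linear.continuous_on[OF bounded_linear_traceless_part])
qed

text \<open>Summing \<open>elliptic_equation\<close> over the basis gives an equation whose
  ellipticity is controlled by \<open>E\<close> itself. Near \<open>p\<close> this is uniform
  because \<open>E\<close> exceeds half its positive maximum, so the strong maximum principle
  applies.\<close>

lemma maximum_locally_constant: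
  assumes p: "p \<in> U" "E p = M" "M > 0" and le: "\<And>x. x \<in> U \<Longrightarrow> E x \<le> M"
  obtains e where "e > 0" "ball p e \<subseteq> U" "\<And>x. x \<in> ball p e \<Longrightarrow> E x = M"
proof -
  obtain r where r: "r > 0" "cball p r \<subseteq> U"
    using open_U p(1) open_contains_cball by blast
  have contE: "continuous_on U E"
    by (intro continuous_at_imp_continuous_on ballI has_derivative_continuous[OF E'])
  define b where "b x = (\<Sum>k\<in>Basis. drift x k)" for x
  have contb: "continuous_on U b" unfolding b_def by (intro continuous_intros continuous_drift)
  have bnd: "\<exists>C. \<forall>x\<in>cball p r. norm (f x) \<le> C" if "continuous_on U f" for f :: "real^4 \<Rightarrow> real^4"
  proof -
    have "compact (f ` cball p r)"
      using compact_continuous_image[OF continuous_on_subset[OF that r(2)] compact_cball] .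
    then have "bounded (f ` cball p r)" by (rule compact_imp_bounded)
    then show ?thesis by (simp add: bounded_iff)
  qed
  obtain C1 where C1: "\<And>x. x \<in> cball p r \<Longrightarrow> norm (b x) \<le> C1" using bnd[OF contb] by blast
  have "\<forall>k. \<exists>C. \<forall>x\<in>cball p r. norm (B x *v k) \<le> C"
    by (intro allI bnd bounded_bilinear.continuous_on[OF bounded_bilinear_matrix_vector_mult]
        continuous_B continuous_on_const)
  from choice[OF this]
  obtain C2 where C2: "\<And>x k. x \<in> cball p r \<Longrightarrow> norm (B x *v k) \<le> C2 k" by blast
  \<comment> \<open>A single constant dominates the summed drift, the coefficient \<open>E\<close>
    (at most \<open>M\<close>) and the vectors \<open>B x *v k\<close> for basis vectors
    \<open>k\<close>.\<close>
  define C where "C = Max (insert C1 (insert M (C2 ` Basis)))"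
  have C: "C1 \<le> C" "M \<le> C" "\<And>k. k \<in> Basis \<Longrightarrow> C2 k \<le> C"
    unfolding C_def by (rule Max_ge; auto)+
  \<comment> \<open>The ball provides bounded coefficients by compactness of its closure; the
    condition on \<open>E\<close> provides the ellipticity constant \<open>M / 2\<close>.\<close>
  define V where "V = ball p r \<inter> E -` {M / 2<..}"
  have VU: "V \<subseteq> U" and Vr: "V \<subseteq> cball p r" using r by (auto simp: V_def)
  have "continuous_on (ball p r) E"
    by (rule continuous_on_subset[OF contE]) (use r(2) ball_subset_cball in blast)
  then have "open V"
    unfolding V_def by (rule continuous_open_preimage) auto
  show ?thesis
  proof (rule strong_maximum_principle[OF \<open>open V\<close>, of E E' E'' M "M / 2" E C "\<lambda>x k. B x *v k" b p])
    show "(E has_derivative E' x) (at x)" "((\<lambda>x. E' x v) has_derivative E'' x v) (at x)"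
      "E x \<le> M" if "x \<in> V" for x v
      using that VU E' E'' le by auto
    show "M / 2 \<le> E x \<and> E x \<le> C" if "x \<in> V" for x
      using that le[of x] VU C(2) by (auto simp: V_def)
    show "norm (B x *v k) \<le> C" if "x \<in> V" "k \<in> Basis" for x k
      using that Vr C2[of x k] C(3)[of k] by fastforce
    show "norm (b x) \<le> C" if "x \<in> V" for x
      using that Vr C1[of x] C(1) by fastforce
    show "(\<Sum>k\<in>Basis. E x * E'' x k k + E'' x (B x *v k) (B x *v k)) = E' x (b x)" if "x \<in> V" for x
    proof -
      have "x \<in> U" using that VU by auto
      then show ?thesis
        using has_derivative_linear[OF E'[OF \<open>x \<in> U\<close>]]
        by (simp add: elliptic_equation b_def linear_sum)
    qed
    show "M / 2 > 0" "p \<in> V" "E p = M" using p r by (auto simp: V_def)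
  next
    fix e assume "e > 0" "ball p e \<subseteq> V" "\<And>x. x \<in> ball p e \<Longrightarrow> E x = M"
    then show ?thesis using that[of e] VU by blast
  qed
qed

text \<open>With \<open>E'\<close> zero and \<open>E\<close> positive, the second relation
  \<open>E'_B_eq\<close> forces \<open>R'\<close> to vanish. Then the gradient \<open>Lam\<close> is
  zero, and so is every term of the equation for the covariant derivative.\<close>

lemma parallel_of_constant:
  assumes "x \<in> U" "M > 0" and const: "\<And>y. y \<in> U \<Longrightarrow> E y = M"
  shows "covd G A x i = 0"
proof -
  have "(E has_derivative (\<lambda>h. 0)) (at x)"
    using has_derivative_transform_within_open[OF has_derivative_const open_U \<open>x \<in> U\<close>, of M E] const
    by simp
  then have "E' x = (\<lambda>h. 0)" using E'[OF \<open>x \<in> U\<close>] has_derivative_unique by blast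
  then have "R' x v = 0" for v
    using E'_B_eq[OF \<open>x \<in> U\<close>, of v] const[OF \<open>x \<in> U\<close>] \<open>M > 0\<close> by simp
  then have "G x *v Lam G A x = 0"
    using G_mult_Lam[OF \<open>x \<in> U\<close>] inner_eq_zero_iff by metis
  moreover have "det (G x) \<noteq> 0"
    using hermitian[OF \<open>x \<in> U\<close>] by (simp add: hermitian_endomorphism_def)
  ultimately have "Lam G A x = 0"
    by (metis invertible_det_nz invertible_left_inverse matrix_left_invertible_ker)
  then show ?thesis
    by (simp add: covd_A[OF \<open>x \<in> U\<close>]) (simp add: outer_def vec_eq_iff)
qed

end

section \<open>The maximum on a closed manifold\<close>

lemma im_square_similar:
  assumes "M' ** N = N ** M" "det N \<noteq> 0"
  shows "im_square M' = im_square M"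
proof -
  obtain H where H: "N ** H = mat 1" "H ** N = mat 1"
    using assms(2) by (auto simp: invertible_det_nz[symmetric] invertible_def)
  have tr: "trace P' = trace P" if "P' ** N = N ** P" for P P' :: "real^4^4"
  proof -
    have "H ** P' ** N = P"
      using that H(2) by (simp add: matrix_mul_assoc[symmetric] that) (simp add: matrix_mul_assoc)
    then show ?thesis using trace_similar[OF H(1), of P'] by simp
  qed
  have 1: "traceless_part M' ** N = N ** traceless_part M"
    by (simp add: traceless_part_mult mult_traceless_part assms tr[OF assms(1)])
  have "(traceless_part M' ** traceless_part M') ** N = N ** (traceless_part M ** traceless_part M)"
    by (simp add: 1 flip: matrix_mul_assoc) (simp add: 1 matrix_mul_assoc)
  from tr[OF this] show ?thesis by (simp add: im_square_def)
qed

lemma chart_inj_on: "is_chart X c \<Longrightarrow> inj_on (snd c) (fst c)"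
  unfolding is_chart_def
  by (metis homeomorphic_imp_injective_map openin_subset topspace_subtopology_subset)

lemma chart_continuous_map:
  "is_chart X c \<Longrightarrow> continuous_map (subtopology X (fst c)) (top_of_set (cdom c)) (snd c)"
  unfolding is_chart_def cdom_def by (simp add: homeomorphic_imp_continuous_map)

text \<open>The two matrices of \<open>A\<close> are intertwined by the Jacobian of the transition
  map. Its invertibility is read off from the transformation law of the nondegenerate metric by
  taking determinants.\<close>

lemma im_square_chart_independent:
  assumes "smooth_atlas X At" "pseudo_metric At G" "smooth_11_field At A"
    and c: "c \<in> At" and d: "d \<in> At" and p: "p \<in> fst c" "p \<in> fst d"
  shows "im_square (A c (snd c p)) = im_square (A d (snd d p))"
proof -
  let ?x = "snd c p"
  have inj: "inj_on (snd c) (fst c)"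
    using chart_inj_on[of X c] assms(1) c by (simp add: smooth_atlas_def)
  have x: "?x \<in> overlap c d" using p by (auto simp: overlap_def)
  have t: "trans_map c d ?x = snd d p" using inj p by (simp add: trans_map_def)
  let ?N = "jac (trans_map c d) ?x"
  have "A d (snd d p) ** ?N = ?N ** A c ?x"
    using assms(3) c d x t unfolding smooth_11_field_def by metis
  moreover have "G c ?x = transpose ?N ** G d (snd d p) ** ?N"
    using assms(2) c d x t unfolding pseudo_metric_def smooth_02_field_def by metis
  then have "det (G c ?x) = det (transpose ?N) * det (G d (snd d p)) * det ?N"
    by (simp add: det_mul)
  moreover have "det (G c ?x) \<noteq> 0"
    using assms(2) c p by (auto simp: pseudo_metric_def cdom_def)
  ultimately show ?thesis using im_square_similar by fastforce
qed

lemma local_solution_chart: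
  assumes "smooth_atlas X At" "kaehler_surface X At G J" "in_AgJ At G J A" "c \<in> At"
  shows "local_solution (cdom c) (G c) (J c) (A c)"
proof
  show "open (cdom c)" using assms(1,4) by (auto simp: smooth_atlas_def is_chart_def cdom_def)
  show "smooth_on (cdom c) (A c)" using assms(3,4) by (auto simp: in_AgJ_def smooth_11_field_def)
next
  fix x assume x: "x \<in> cdom c"
  show "det (G c x) \<noteq> 0" "transpose (G c x) = G c x"
    "J c x ** J c x = - mat 1" "transpose (J c x) ** G c x = - (G c x ** J c x)"
    using assms(2,4) x by (auto simp: kaehler_surface_def pseudo_metric_def)
  show "G c x ** A c x = transpose (A c x) ** G c x" "A c x ** J c x = J c x ** A c x"
    using assms(3,4) x by (auto simp: in_AgJ_def)
  show "covd (G c) (A c) x i =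
        outer (Lam (G c) (A c) x) (G c x *v axis i 1) + outer (axis i 1) (G c x *v Lam (G c) (A c) x)
        + outer (J c x *v Lam (G c) (A c) x) (G c x *v (J c x *v axis i 1))
        + outer (J c x *v axis i 1) (G c x *v (J c x *v Lam (G c) (A c) x))" for i
    using assms(3,4) x by (simp add: in_AgJ_def Let_def)
qed

theorem theorem5p1:
  fixes X :: "'m topology" and At :: "'m chart set"
    and G J A :: "'m chart \<Rightarrow> real^4 \<Rightarrow> real^4^4"
  assumes "closed_connected_4manifold X At"
    and "kaehler_surface X At G J"
    and "in_AgJ At G J A"
    and "\<exists>c\<in>At. \<exists>x\<in>cdom c. \<exists>\<rho>. Im \<rho> \<noteq> 0 \<and> complex_eigenvalue (A c x) \<rho>"
  shows "\<forall>c\<in>At. \<forall>x\<in>cdom c. \<forall>i. covd (G c) (A c) x i = 0"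
proof -
  have atlas: "smooth_atlas X At" and conn: "connected_space X" and comp: "compact_space X"
    using assms(1) by (auto simp: closed_connected_4manifold_def)
  have chart: "is_chart X c" if "c \<in> At" for c using atlas that by (auto simp: smooth_atlas_def)
  have cover: "topspace X = (\<Union>c\<in>At. fst c)" using atlas by (auto simp: smooth_atlas_def)
  have opn: "openin X (fst c)" if "c \<in> At" for c using chart[OF that] by (simp add: is_chart_def)
  have loc: "local_solution (cdom c) (G c) (J c) (A c)" if "c \<in> At" for c
    using local_solution_chart[OF atlas assms(2,3) that] .
  have cont: "continuous_map (subtopology X (fst c)) euclideanreal (\<lambda>p. im_square (A c (snd c p)))"
    if "c \<in> At" for c
  proof -
    interpret local_solution "cdom c" "G c" "J c" "A c" by (rule loc[OF that])
    have "continuous_on (cdom c) E"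
      by (intro continuous_at_imp_continuous_on ballI has_derivative_continuous[OF E'])
    then have "continuous_map (top_of_set (cdom c)) euclideanreal E"
      by simp
    from continuous_map_compose[OF chart_continuous_map[OF chart[OF that]] this]
    show ?thesis by (simp add: comp_def E_def)
  qed
  have indep: "im_square (A c (snd c p)) = im_square (A d (snd d p))"
    if "c \<in> At" "d \<in> At" "p \<in> topspace X \<inter> fst c \<inter> fst d" for c d p
    using im_square_chart_independent[OF atlas _ _ that(1,2)] that assms(2,3)
    by (auto simp: kaehler_surface_def in_AgJ_def)
  \<comment> \<open>The values of \<open>im_square\<close> in the charts agree on overlaps and glue
    to one continuous function on the manifold.\<close>
  obtain F where F: "continuous_map X euclideanreal F"
    "\<And>p c. c \<in> At \<Longrightarrow> p \<in> topspace X \<inter> fst c \<Longrightarrow> F p = im_square (A c (snd c p))"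
    by (rule pasting_lemma_exists[where I=At and T=fst and X=X and Y=euclideanreal
        and f="\<lambda>c p. im_square (A c (snd c p))", OF equalityD1[OF cover] opn cont indep]) blast+
  have F': "F p = im_square (A c (snd c p))" if "c \<in> At" "p \<in> fst c" for c p
    using F(2)[of c] that cover by auto
  \<comment> \<open>The non-real eigenvalue makes \<open>F\<close> positive somewhere, hence its
    maximum is positive.\<close>
  obtain c0 p0 where c0: "c0 \<in> At" "p0 \<in> fst c0" "F p0 > 0"
  proof -
    obtain c p \<rho> where c: "c \<in> At" "p \<in> fst c" "Im \<rho> \<noteq> 0" "complex_eigenvalue (A c (snd c p)) \<rho>"
      using assms(4) by (auto simp: cdom_def)
    then have "snd c p \<in> cdom c" by (simp add: cdom_def)
    then interpret hermitian_endomorphism "G c (snd c p)" "J c (snd c p)" "A c (snd c p)"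
      using loc[OF c(1)] by (simp add: local_solution_def)
    show ?thesis using that[OF c(1,2)] im_square_pos[OF c(4,3)] F'[OF c(1,2)] by simp
  qed
  have p0: "p0 \<in> topspace X" using c0 cover by auto
  have "compact (F ` topspace X)"
    using image_compactin[OF _ F(1)] comp by (auto simp: compact_space_def)
  moreover have "F ` topspace X \<noteq> {}" using p0 by blast
  ultimately obtain q where q: "q \<in> topspace X" "\<And>p. p \<in> topspace X \<Longrightarrow> F p \<le> F q"
    using compact_attains_sup[of "F ` topspace X"] by blast
  define M where "M = F q"
  have "M > 0" using q(2)[OF p0] c0(3) by (simp add: M_def)
  have le: "im_square (A c x) \<le> M" if "c \<in> At" "x \<in> cdom c" for c x
  proof -
    obtain p where "p \<in> fst c" "x = snd c p" using \<open>x \<in> cdom c\<close> by (auto simp: cdom_def)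
    then show ?thesis using F'[of c p] q(2)[of p] that cover by (auto simp: M_def)
  qed
  \<comment> \<open>The maximum set is shown to be clopen; it is written with a singleton so that it
    has the form of a preimage of a closed set.\<close>
  define S where "S = {p \<in> topspace X. F p \<in> {M}}"
  have "closedin X S"
    unfolding S_def by (rule closedin_continuous_map_preimage[OF F(1)]) simp
  moreover have "openin X S"
  proof (subst openin_subopen, intro ballI)
    fix p assume p: "p \<in> S"
    then obtain c where c: "c \<in> At" "p \<in> fst c" using cover by (auto simp: S_def)
    interpret local_solution "cdom c" "G c" "J c" "A c" by (rule loc[OF c(1)])
    have "snd c p \<in> cdom c" "E (snd c p) = M"
      using c p F'[OF c] by (auto simp: cdom_def S_def E_def)
    then obtain e where e: "e > 0" "ball (snd c p) e \<subseteq> cdom c"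
      "\<And>x. x \<in> ball (snd c p) e \<Longrightarrow> E x = M"
      using maximum_locally_constant[of "snd c p" M] \<open>M > 0\<close> le[OF c(1)] unfolding E_def by blast
    \<comment> \<open>The coordinate ball on which \<open>E\<close> equals \<open>M\<close> is
      pulled back through the chart; since the chart domain is open, the result is open in
      \<open>X\<close>.\<close>
    let ?T = "{q \<in> topspace (subtopology X (fst c)). snd c q \<in> ball (snd c p) e}"
    have "openin (top_of_set (cdom c)) (ball (snd c p) e)"
      using e(2) open_U by (simp add: openin_open_eq)
    then have "openin (subtopology X (fst c)) ?T"
      by (rule openin_continuous_map_preimage[OF chart_continuous_map[OF chart[OF c(1)]]])
    then have "openin X ?T" using opn[OF c(1)] openin_trans_full by blast
    moreover have "p \<in> ?T" using c p e(1) by (auto simp: S_def)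
    moreover have "?T \<subseteq> S" using e(3) F'[OF c(1)] by (auto simp: S_def E_def)
    ultimately show "\<exists>T. openin X T \<and> p \<in> T \<and> T \<subseteq> S" by blast
  qed
  moreover have "q \<in> S" using q(1) by (simp add: S_def M_def)
  ultimately have S: "S = topspace X" using conn unfolding connected_space_clopen_in by blast
  show ?thesis
  proof (intro ballI allI)
    fix c x i assume c: "c \<in> At" and x: "x \<in> cdom c"
    interpret local_solution "cdom c" "G c" "J c" "A c" by (rule loc[OF c])
    have "E y = M" if "y \<in> cdom c" for y
    proof -
      obtain p where "p \<in> fst c" "y = snd c p" using \<open>y \<in> cdom c\<close> by (auto simp: cdom_def)
      moreover from this have "p \<in> S" using S cover c by auto
      ultimately show ?thesis using F'[of c p] c by (simp add: S_def E_def)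
    qed
    then show "covd (G c) (A c) x i = 0" using parallel_of_constant[OF x \<open>M > 0\<close>] by blast
  qed
qed

end
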